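(* Let $(\mathfrak{h},\nabla)$ be a three-dimensional real flat Lie algebra which admits a right-identity element. Then $(\mathfrak{h},\nabla)$ is isomorphic to one of the following flat Lie algebras, each given on a basis $e_1,e_2,e_3$ by its non-zero products $\nabla_{e_i}e_j$, with the indicated right-identity $e$ (the underlying Lie algebra is indicated at the start of each group): (I) On $3\mathfrak{g}_1$: $\mathfrak{h}_1$: $\nabla_{e_3}e_j=e_j$ ($j=1,2,3$), $\nabla_{e_1}e_3=e_1$, $\nabla_{e_2}e_3=e_2$; $e=e_3$. $\mathfrak{h}_2^{b}$, $b\in\mathbb{R}^*$: $\nabla_{e_3}e_j=e_j$ ($j=1,2,3$), $\nabla_{e_1}e_1=e_1+e_2$, $\nabla_{e_1}e_2=be_3$, $\nabla_{e_1}e_3=e_1$, $\nabla_{e_2}e_1=be_3$, $\nabla_{e_2}e_2=be_1-be_3$, $\nabla_{e_2}e_3=e_2$; $e=e_3$. $\mathfrak{h}_3$: $\nabla_{e_3}e_j=e_j$ ($j=1,2,3$), $\nabla_{e_1}e_3=e_1$, $\nabla_{e_2}e_2=e_1$, $\nabla_{e_2}e_3=e_2$; $e=e_3$. (II) On $3\mathfrak{g}_{2,1}\oplus\mathfrak{g}_1$: $\mathfrak{h}_4^a$, $a\in\mathbb{R}^*$: $\nabla_{e_1}e_j=e_j$ ($j=1,2,3$), $\nabla_{e_2}e_1=e_2$, $\nabla_{e_3}e_1=e_3$, $\nabla_{e_3}e_2=e_2$, $\nabla_{e_3}e_3=e_2+ae_3$; $e=e_1$. $\mathfrak{h}_5$: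 $\nabla_{e_1}e_j=e_j$ ($j=1,2,3$), $\nabla_{e_2}e_1=e_2$, $\nabla_{e_3}e_1=e_3$, $\nabla_{e_3}e_2=e_2$, $\nabla_{e_3}e_3=e_3$; $e=e_1$. $\mathfrak{h}_6$: $\nabla_{e_1}e_j=e_j$ ($j=1,2,3$), $\nabla_{e_2}e_1=e_2$, $\nabla_{e_3}e_1=e_3$, $\nabla_{e_3}e_2=e_2$; $e=e_1$. $\mathfrak{h}_7$: $\nabla_{e_1}e_j=e_j$ ($j=1,2,3$), $\nabla_{e_2}e_1=e_2$, $\nabla_{e_2}e_2=e_3$, $\nabla_{e_3}e_1=e_3$, $\nabla_{e_3}e_2=e_2$, $\nabla_{e_3}e_3=2e_3$; $e=e_1$. $\mathfrak{h}_8$: $\nabla_{e_1}e_j=e_j$ ($j=1,2,3$), $\nabla_{e_2}e_1=e_2$, $\nabla_{e_2}e_2=-e_3$, $\nabla_{e_3}e_1=e_3$, $\nabla_{e_3}e_2=e_2$, $\nabla_{e_3}e_3=2e_3$; $e=e_1$. $\mathfrak{h}_9^a$, $a\in\mathbb{R}$: $\nabla_{e_1}e_1=e_1-e_2$, $\nabla_{e_1}e_2=e_2$, $\nabla_{e_1}e_3=-e_2+e_3$, $\nabla_{e_2}e_1=e_2$, $\nabla_{e_3}e_1=-e_2+e_3$, $\nabla_{e_3}e_2=e_2$, $\nabla_{e_3}e_3=ae_2+e_3$; $e=e_1+e_2$. $\mathfrak{h}_{10}^{\lambda,a,b}$, $\lambda,a,b\in\mathbb{R}^*$, $b\ne a$: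 $\nabla_{e_1}e_1=\frac{a}{b}e_1-\frac{\lambda(a-b)}{b}e_3$, $\nabla_{e_1}e_2=e_2$, $\nabla_{e_1}e_3=\frac1\lambda e_1$, $\nabla_{e_2}e_1=e_2$, $\nabla_{e_2}e_3=\frac1\lambda e_2$, $\nabla_{e_3}e_1=\frac1\lambda e_1$, $\nabla_{e_3}e_2=\frac{1+\lambda}{\lambda}e_2$, $\nabla_{e_3}e_3=\frac1\lambda e_3$; $e=\lambda e_3$. $\mathfrak{h}_{11}^{\lambda}$, $\lambda\in\mathbb{R}^*$: $\nabla_{e_1}e_1=e_1$, $\nabla_{e_1}e_2=e_2$, $\nabla_{e_1}e_3=\frac1\lambda e_1$, $\nabla_{e_2}e_1=e_2$, $\nabla_{e_2}e_3=\frac1\lambda e_2$, $\nabla_{e_3}e_1=\frac1\lambda e_1$, $\nabla_{e_3}e_2=\frac{1+\lambda}{\lambda}e_2$, $\nabla_{e_3}e_3=\frac1\lambda e_3$; $e=\lambda e_3$. $\mathfrak{h}_{12}^{\lambda}$, $\lambda\in\mathbb{R}^*$: $\nabla_{e_1}e_1=\lambda e_3$, $\nabla_{e_1}e_2=e_2$, $\nabla_{e_1}e_3=\frac1\lambda e_1$, $\nabla_{e_2}e_1=e_2$, $\nabla_{e_2}e_3=\frac1\lambda e_2$, $\nabla_{e_3}e_1=\frac1\lambda e_1$, $\nabla_{e_3}e_2=\frac{1+\lambda}{\lambda}e_2$, $\nabla_{e_3}e_3=\frac1\lambda e_3$; $e=\lambda e_3$. $\mathfrak{h}_{13}^{\lambda}$,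 $\lambda\in\mathbb{R}^*$: $\nabla_{e_1}e_1=e_1$, $\nabla_{e_1}e_3=\frac1\lambda e_1$, $\nabla_{e_2}e_3=\frac1\lambda e_2$, $\nabla_{e_3}e_1=\frac1\lambda e_1$, $\nabla_{e_3}e_2=\frac{1+\lambda}{\lambda}e_2$, $\nabla_{e_3}e_3=\frac1\lambda e_3$; $e=\lambda e_3$. $\mathfrak{h}_{14}^{\lambda}$, $\lambda\in\mathbb{R}^*$: $\nabla_{e_1}e_3=\frac1\lambda e_1$, $\nabla_{e_2}e_3=\frac1\lambda e_2$, $\nabla_{e_3}e_1=\frac1\lambda e_1$, $\nabla_{e_3}e_2=\frac{1+\lambda}{\lambda}e_2$, $\nabla_{e_3}e_3=\frac1\lambda e_3$; $e=\lambda e_3$. (III) On the Heisenberg algebra: $\mathfrak{h}_{15}$: $\nabla_{e_1}e_1=e_3$, $\nabla_{e_1}e_2=e_1$, $\nabla_{e_2}e_1=e_1-e_3$, $\nabla_{e_2}e_2=e_2$, $\nabla_{e_2}e_3=e_3$, $\nabla_{e_3}e_2=e_3$; $e=e_2$. $\mathfrak{h}_{16}$: $\nabla_{e_1}e_2=e_1$, $\nabla_{e_2}e_1=e_1-e_3$, $\nabla_{e_2}e_2=e_2$, $\nabla_{e_2}e_3=e_3$, $\nabla_{e_3}e_2=e_3$; $e=e_2$. (IV) On $\mathfrak{g}_{3,2}$: $\mathfrak{h}_{17}^{\mu}$, $\mu\in\mathbb{R}^*$: $\nabla_{e_1}e_3=\frac1\mu e_1$, $\nabla_{e_2}e_3=\frac1\mu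 e_2$, $\nabla_{e_3}e_1=\frac{1-\mu}{\mu}e_1$, $\nabla_{e_3}e_2=-e_1+\frac{1-\mu}{\mu}e_2$, $\nabla_{e_3}e_3=\frac1\mu e_3$; $e=\mu e_3$. (V) On $\mathfrak{g}_{3,3}$: $\mathfrak{h}_{18}^{\eta}$, $\eta\in\mathbb{R}^*$: $\nabla_{e_1}e_3=\frac1\eta e_1$, $\nabla_{e_2}e_3=\frac1\eta e_2$, $\nabla_{e_3}e_1=\frac{1-\eta}{\eta}e_1$, $\nabla_{e_3}e_2=\frac{1-\eta}{\eta}e_2$, $\nabla_{e_3}e_3=\frac1\eta e_3$; $e=\eta e_3$. (VI) On $\mathfrak{g}_{3,4}$ with $0<|\alpha|<1$: $\mathfrak{h}_{19}^{\alpha,\gamma}$, $\gamma\in\mathbb{R}^*$: $\nabla_{e_1}e_3=\frac1\gamma e_1$, $\nabla_{e_2}e_3=\frac1\gamma e_2$, $\nabla_{e_3}e_1=(-1+\frac1\gamma)e_1$, $\nabla_{e_3}e_2=(-\alpha+\frac1\gamma)e_2$, $\nabla_{e_3}e_3=\frac1\gamma e_3$; $e=\gamma e_3$. $\mathfrak{h}_{20}^{\gamma}$, $\gamma\in\mathbb{R}^*$ (here $\alpha=\frac12$): $\nabla_{e_1}e_3=\frac1\gamma e_1$, $\nabla_{e_2}e_2=e_1$, $\nabla_{e_2}e_3=\frac1\gamma e_2$, $\nabla_{e_3}e_1=(-1+\frac1\gamma)e_1$, $\nabla_{e_3}e_2=(-\frac12+\frac1\gamma)e_2$, $\nabla_{e_3}e_3=\frac1\gamma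 e_3$; $e=\gamma e_3$. (VII) On $\mathfrak{g}_{3,4}$ with $\alpha=-1$: $\mathfrak{h}_{21}^{\nu}$, $\nu>0$: $\nabla_{e_1}e_3=\frac1\nu e_1$, $\nabla_{e_2}e_3=\frac1\nu e_2$, $\nabla_{e_3}e_1=\frac{1-\nu}{\nu}e_1$, $\nabla_{e_3}e_2=\frac{1+\nu}{\nu}e_2$, $\nabla_{e_3}e_3=\frac1\nu e_3$; $e=\nu e_3$. (VIII) On $\mathfrak{g}_{3,5}$ with $\beta>0$: $\mathfrak{h}_{22}^{\beta,\delta_1}$, $\delta_1\in\mathbb{R}^*$: $\nabla_{e_1}e_3=\frac1{\delta_1}e_1$, $\nabla_{e_2}e_3=\frac1{\delta_1}e_2$, $\nabla_{e_3}e_1=\frac{-\beta\delta_1+1}{\delta_1}e_1+e_2$, $\nabla_{e_3}e_2=-e_1+\frac{-\beta\delta_1+1}{\delta_1}e_2$, $\nabla_{e_3}e_3=\frac1{\delta_1}e_3$; $e=\delta_1e_3$. (IX) On $\mathfrak{g}_{3,5}$ with $\beta=0$: $\mathfrak{h}_{23}^{\delta_2}$, $\delta_2>0$: $\nabla_{e_1}e_3=\frac1{\delta_2}e_1$, $\nabla_{e_2}e_3=\frac1{\delta_2}e_2$, $\nabla_{e_3}e_1=\frac1{\delta_2}e_1+e_2$, $\nabla_{e_3}e_2=-e_1+\frac1{\delta_2}e_2$, $\nabla_{e_3}e_3=\frac1{\delta_2}e_3$; $e=\delta_2e_3$.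
   Context: All Lie algebras are real. A flat Lie algebra $(\mathfrak{h},\nabla)$ is a Lie algebra $\mathfrak{h}$ with a bilinear map $\nabla:\mathfrak{h}\times\mathfrak{h}\to\mathfrak{h}$, $(x,y)\mapsto\nabla_xy$, such that $\nabla_xy-\nabla_yx=[x,y]$ and $\nabla_x\nabla_yz-\nabla_y\nabla_xz-\nabla_{[x,y]}z=0$ for all $x,y,z$ (equivalently, a left-symmetric algebra). A right-identity element is $e\in\mathfrak{h}$ with $\nabla_xe=x$ for all $x\in\mathfrak{h}$. Two flat Lie algebras $(\mathfrak{h},\nabla)$, $(\tilde{\mathfrak{h}},\tilde\nabla)$ are isomorphic if there is a linear isomorphism $\psi$ with $\psi(\nabla_xy)=\tilde\nabla_{\psi(x)}\psi(y)$. $\mathbb{R}^*=\mathbb{R}\setminus\{0\}$. Three-dimensional Lie algebras (non-zero brackets): $3\mathfrak{g}_1$ abelian; $3\mathfrak{g}_{2,1}\oplus\mathfrak{g}_1$: $[e_3,e_2]=e_2$; Heisenberg algebra: $[e_1,e_2]=e_3$; $\mathfrak{g}_{3,2}$: $[e_1,e_3]=e_1$, $[e_2,e_3]=e_1+e_2$; $\mathfrak{g}_{3,3}$: $[e_1,e_3]=e_1$, $[e_2,e_3]=e_2$; $\mathfrak{g}_{3,4}$: $[e_1,e_3]=e_1$, $[e_2,e_3]=\alpha e_2$ with $-1\le\alpha<1$, $\alpha\neq0$; $\mathfrak{g}_{3,5}$: $[e_1,e_3]=\beta e_1-e_2$, $[e_2,e_3]=e_1+\beta e_2$ with $\beta\ge0$.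 *)

theory Defs
  imports "HOL-Analysis.Analysis"
begin

definition lie_algebra :: "('a::real_vector \<Rightarrow> 'a \<Rightarrow> 'a) \<Rightarrow> bool" where
  "lie_algebra br \<longleftrightarrow>
     bilinear br \<and>
     (\<forall>x. br x x = 0) \<and>
     (\<forall>x y z. br x (br y z) + br y (br z x) + br z (br x y) = 0)"

definition flat_lie_algebra ::
  "('a::real_vector \<Rightarrow> 'a \<Rightarrow> 'a) \<Rightarrow> ('a \<Rightarrow> 'a \<Rightarrow> 'a) \<Rightarrow> bool" where
  "flat_lie_algebra br nab \<longleftrightarrow>
     lie_algebra br \<and>
     bilinear nab \<and>
     (\<forall>x y. nab x y - nab y x = br x y) \<and>
     (\<forall>x y z. nab x (nab y z) - nab y (nab x z) - nab (br x y) z = 0)"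

definition right_identity :: "('a \<Rightarrow> 'a \<Rightarrow> 'a) \<Rightarrow> 'a \<Rightarrow> bool" where
  "right_identity nab e \<longleftrightarrow> (\<forall>x. nab x e = x)"

definition flat_isomorphic ::
  "('a::real_vector \<Rightarrow> 'a \<Rightarrow> 'a) \<Rightarrow> ('b::real_vector \<Rightarrow> 'b \<Rightarrow> 'b) \<Rightarrow> bool" where
  "flat_isomorphic nab nab' \<longleftrightarrow>
     (\<exists>\<psi>. linear \<psi> \<and> bij \<psi> \<and> (\<forall>x y. \<psi> (nab x y) = nab' (\<psi> x) (\<psi> y)))"

abbreviation e1 :: "real^3" where "e1 \<equiv> axis 1 1"
abbreviation e2 :: "real^3" where "e2 \<equiv> axis 2 1"
abbreviation e3 :: "real^3" where "e3 \<equiv> axis 3 1"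

text \<open>
  The bilinear map on \<open>\<real>\<^sup>3\<close> whose value at the \<open>i\<close>-th and \<open>j\<close>-th basis vectors is
  the \<open>j\<close>-th entry of the \<open>i\<close>-th row of the given 3-by-3 table.
\<close>

definition structure_product :: "(real^3) list list \<Rightarrow> real^3 \<Rightarrow> real^3 \<Rightarrow> real^3" where
  "structure_product tbl x y =
     (\<Sum>i\<in>UNIV. \<Sum>j\<in>UNIV.
        (x $ i * y $ j) *\<^sub>R ((vector (map vector tbl) :: ((real^3)^3)^3) $ i $ j))"

definition lie_3g1 :: "real^3 \<Rightarrow> real^3 \<Rightarrow> real^3" where
  "lie_3g1 = structure_product
     [[0, 0, 0],
      [0, 0, 0],
      [0, 0, 0]]"

definition lie_g21_g1 :: "real^3 \<Rightarrow> real^3 \<Rightarrow> real^3" where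
  "lie_g21_g1 = structure_product
     [[0, 0, 0],
      [0, 0, - e2],
      [0, e2, 0]]"

definition lie_heisenberg :: "real^3 \<Rightarrow> real^3 \<Rightarrow> real^3" where
  "lie_heisenberg = structure_product
     [[0, e3, 0],
      [- e3, 0, 0],
      [0, 0, 0]]"

definition lie_g32 :: "real^3 \<Rightarrow> real^3 \<Rightarrow> real^3" where
  "lie_g32 = structure_product
     [[0, 0, e1],
      [0, 0, e1 + e2],
      [- e1, - (e1 + e2), 0]]"

definition lie_g33 :: "real^3 \<Rightarrow> real^3 \<Rightarrow> real^3" where
  "lie_g33 = structure_product
     [[0, 0, e1],
      [0, 0, e2],
      [- e1, - e2, 0]]"

definition lie_g34 :: "real \<Rightarrow> real^3 \<Rightarrow> real^3 \<Rightarrow> real^3" where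
  "lie_g34 \<alpha> = structure_product
     [[0, 0, e1],
      [0, 0, \<alpha> *\<^sub>R e2],
      [- e1, - \<alpha> *\<^sub>R e2, 0]]"

definition lie_g35 :: "real \<Rightarrow> real^3 \<Rightarrow> real^3 \<Rightarrow> real^3" where
  "lie_g35 \<beta> = structure_product
     [[0, 0, \<beta> *\<^sub>R e1 - e2],
      [0, 0, e1 + \<beta> *\<^sub>R e2],
      [- (\<beta> *\<^sub>R e1 - e2), - (e1 + \<beta> *\<^sub>R e2), 0]]"

text \<open>
  \<open>model br nab e\<close>: the list of normal forms, given by the underlying Lie bracket \<open>br\<close>,
  the table of products \<open>nab\<close> and the indicated right identity \<open>e\<close>.
\<close>

inductive model ::
  "(real^3 \<Rightarrow> real^3 \<Rightarrow> real^3) \<Rightarrow> (real^3 \<Rightarrow> real^3 \<Rightarrow> real^3) \<Rightarrow> real^3 \<Rightarrow> bool" where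
  h1: "model lie_3g1
    (structure_product
     [[0, 0, e1],
      [0, 0, e2],
      [e1, e2, e3]])
    e3"
| h2: "b \<noteq> 0 \<Longrightarrow> model lie_3g1
    (structure_product
     [[e1 + e2, b *\<^sub>R e3, e1],
      [b *\<^sub>R e3, b *\<^sub>R e1 - b *\<^sub>R e3, e2],
      [e1, e2, e3]])
    e3"
| h3: "model lie_3g1
    (structure_product
     [[0, 0, e1],
      [0, e1, e2],
      [e1, e2, e3]])
    e3"
| h4: "a \<noteq> 0 \<Longrightarrow> model lie_g21_g1
    (structure_product
     [[e1, e2, e3],
      [e2, 0, 0],
      [e3, e2, e2 + a *\<^sub>R e3]])
    e1"
| h5: "model lie_g21_g1
    (structure_product
     [[e1, e2, e3],
      [e2, 0, 0],
      [e3, e2, e3]])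
    e1"
| h6: "model lie_g21_g1
    (structure_product
     [[e1, e2, e3],
      [e2, 0, 0],
      [e3, e2, 0]])
    e1"
| h7: "model lie_g21_g1
    (structure_product
     [[e1, e2, e3],
      [e2, e3, 0],
      [e3, e2, 2 *\<^sub>R e3]])
    e1"
| h8: "model lie_g21_g1
    (structure_product
     [[e1, e2, e3],
      [e2, - e3, 0],
      [e3, e2, 2 *\<^sub>R e3]])
    e1"
| h9: "model lie_g21_g1
    (structure_product
     [[e1 - e2, e2, - e2 + e3],
      [e2, 0, 0],
      [- e2 + e3, e2, a *\<^sub>R e2 + e3]])
    (e1 + e2)"
| h10: "\<lbrakk>lam \<noteq> 0; a \<noteq> 0; b \<noteq> 0; b \<noteq> a\<rbrakk> \<Longrightarrow> model lie_g21_g1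
    (structure_product
     [[(a / b) *\<^sub>R e1 - (lam * (a - b) / b) *\<^sub>R e3, e2, (1 / lam) *\<^sub>R e1],
      [e2, 0, (1 / lam) *\<^sub>R e2],
      [(1 / lam) *\<^sub>R e1, ((1 + lam) / lam) *\<^sub>R e2, (1 / lam) *\<^sub>R e3]])
    (lam *\<^sub>R e3)"
| h11: "lam \<noteq> 0 \<Longrightarrow> model lie_g21_g1
    (structure_product
     [[e1, e2, (1 / lam) *\<^sub>R e1],
      [e2, 0, (1 / lam) *\<^sub>R e2],
      [(1 / lam) *\<^sub>R e1, ((1 + lam) / lam) *\<^sub>R e2, (1 / lam) *\<^sub>R e3]])
    (lam *\<^sub>R e3)"
| h12: "lam \<noteq> 0 \<Longrightarrow> model lie_g21_g1
    (structure_product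
     [[lam *\<^sub>R e3, e2, (1 / lam) *\<^sub>R e1],
      [e2, 0, (1 / lam) *\<^sub>R e2],
      [(1 / lam) *\<^sub>R e1, ((1 + lam) / lam) *\<^sub>R e2, (1 / lam) *\<^sub>R e3]])
    (lam *\<^sub>R e3)"
| h13: "lam \<noteq> 0 \<Longrightarrow> model lie_g21_g1
    (structure_product
     [[e1, 0, (1 / lam) *\<^sub>R e1],
      [0, 0, (1 / lam) *\<^sub>R e2],
      [(1 / lam) *\<^sub>R e1, ((1 + lam) / lam) *\<^sub>R e2, (1 / lam) *\<^sub>R e3]])
    (lam *\<^sub>R e3)"
| h14: "lam \<noteq> 0 \<Longrightarrow> model lie_g21_g1
    (structure_product
     [[0, 0, (1 / lam) *\<^sub>R e1],
      [0, 0, (1 / lam) *\<^sub>R e2],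
      [(1 / lam) *\<^sub>R e1, ((1 + lam) / lam) *\<^sub>R e2, (1 / lam) *\<^sub>R e3]])
    (lam *\<^sub>R e3)"
| h15: "model lie_heisenberg
    (structure_product
     [[e3, e1, 0],
      [e1 - e3, e2, e3],
      [0, e3, 0]])
    e2"
| h16: "model lie_heisenberg
    (structure_product
     [[0, e1, 0],
      [e1 - e3, e2, e3],
      [0, e3, 0]])
    e2"
| h17: "\<mu> \<noteq> 0 \<Longrightarrow> model lie_g32
    (structure_product
     [[0, 0, (1 / \<mu>) *\<^sub>R e1],
      [0, 0, (1 / \<mu>) *\<^sub>R e2],
      [((1 - \<mu>) / \<mu>) *\<^sub>R e1, - e1 + ((1 - \<mu>) / \<mu>) *\<^sub>R e2, (1 / \<mu>) *\<^sub>R e3]])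
    (\<mu> *\<^sub>R e3)"
| h18: "\<eta> \<noteq> 0 \<Longrightarrow> model lie_g33
    (structure_product
     [[0, 0, (1 / \<eta>) *\<^sub>R e1],
      [0, 0, (1 / \<eta>) *\<^sub>R e2],
      [((1 - \<eta>) / \<eta>) *\<^sub>R e1, ((1 - \<eta>) / \<eta>) *\<^sub>R e2, (1 / \<eta>) *\<^sub>R e3]])
    (\<eta> *\<^sub>R e3)"
| h19: "\<lbrakk>0 < \<bar>\<alpha>\<bar>; \<bar>\<alpha>\<bar> < 1; \<gamma> \<noteq> 0\<rbrakk> \<Longrightarrow> model (lie_g34 \<alpha>)
    (structure_product
     [[0, 0, (1 / \<gamma>) *\<^sub>R e1],
      [0, 0, (1 / \<gamma>) *\<^sub>R e2],
      [(- 1 + 1 / \<gamma>) *\<^sub>R e1, (- \<alpha> + 1 / \<gamma>) *\<^sub>R e2, (1 / \<gamma>) *\<^sub>R e3]])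
    (\<gamma> *\<^sub>R e3)"
| h20: "\<gamma> \<noteq> 0 \<Longrightarrow> model (lie_g34 (1 / 2))
    (structure_product
     [[0, 0, (1 / \<gamma>) *\<^sub>R e1],
      [0, e1, (1 / \<gamma>) *\<^sub>R e2],
      [(- 1 + 1 / \<gamma>) *\<^sub>R e1, (- (1 / 2) + 1 / \<gamma>) *\<^sub>R e2, (1 / \<gamma>) *\<^sub>R e3]])
    (\<gamma> *\<^sub>R e3)"
| h21: "\<nu> > 0 \<Longrightarrow> model (lie_g34 (- 1))
    (structure_product
     [[0, 0, (1 / \<nu>) *\<^sub>R e1],
      [0, 0, (1 / \<nu>) *\<^sub>R e2],
      [((1 - \<nu>) / \<nu>) *\<^sub>R e1, ((1 + \<nu>) / \<nu>) *\<^sub>R e2, (1 / \<nu>) *\<^sub>R e3]])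
    (\<nu> *\<^sub>R e3)"
| h22: "\<lbrakk>\<beta> > 0; \<delta> \<noteq> 0\<rbrakk> \<Longrightarrow> model (lie_g35 \<beta>)
    (structure_product
     [[0, 0, (1 / \<delta>) *\<^sub>R e1],
      [0, 0, (1 / \<delta>) *\<^sub>R e2],
      [((- \<beta> * \<delta> + 1) / \<delta>) *\<^sub>R e1 + e2, - e1 + ((- \<beta> * \<delta> + 1) / \<delta>) *\<^sub>R e2, (1 / \<delta>) *\<^sub>R e3]])
    (\<delta> *\<^sub>R e3)"
| h23: "\<delta> > 0 \<Longrightarrow> model (lie_g35 0)
    (structure_product
     [[0, 0, (1 / \<delta>) *\<^sub>R e1],
      [0, 0, (1 / \<delta>) *\<^sub>R e2],
      [(1 / \<delta>) *\<^sub>R e1 + e2, - e1 + (1 / \<delta>) *\<^sub>R e2, (1 / \<delta>) *\<^sub>R e3]])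
    (\<delta> *\<^sub>R e3)"

end

theory Submission
  imports Defs
begin

text \<open>
  Write \<open>x \<cdot> y\<close> for \<open>\<nabla>\<^sub>x y\<close>, so that flatness says that the associator is symmetric in its first two
  arguments. Putting the right identity \<open>e\<close> in the first argument of this law gives
  \<open>e \<cdot> (y \<cdot> z) = (e \<cdot> y) \<cdot> z + y \<cdot> (e \<cdot> z) - y \<cdot> z\<close>, which says that \<open>D y = e \<cdot> y - y = [e, y]\<close> is a
  derivation of the product, with \<open>D e = 0\<close>. The whole classification is organised by the
  normal form of \<open>D\<close>, because a derivation with eigenvalues \<open>0, \<lambda>, \<mu>\<close> forces the product of the eigenspaces for
  \<open>\<alpha>\<close> and \<open>\<beta>\<close> into the one for \<open>\<alpha> + \<beta>\<close>, and so makes most structure constants vanish.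

  A first restriction is that \<open>e\<close> never lies in the image of \<open>D\<close> (\<open>not_in_image\<close>): if \<open>D u = e\<close>, then the
  powers \<open>e, u, u \<cdot> u, u \<cdot> (u \<cdot> u)\<close> are four independent vectors, since each
  power of \<open>D\<close> kills one more of them. Hence the following possibilities remain.

  \<^item> Both eigenvalues of \<open>D\<close> on the quotient by \<open>e\<close> are nonzero (\<open>diagonal_case\<close>, \<open>jordan_case\<close>,
    \<open>rotation_case\<close>). There is a \<open>D\<close>-invariant plane complementary to \<open>e\<close>, and its products all vanish,
    except that \<open>y \<cdot> y\<close> may be an eigenvector for twice the eigenvalue of \<open>y\<close>.

  \<^item> Exactly one is nonzero (\<open>one_nonzero_case\<close>). The kernel of \<open>D\<close> is a two-dimensional commutative
    associative algebra with unit \<open>e\<close>, and acts on the remaining eigenvector \<open>w\<close> from the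
    right by a character and from the left by a linear functional whose value at \<open>e\<close> is not \<open>1\<close>.

  \<^item> Both vanish but \<open>D \<noteq> 0\<close> (\<open>nilpotent_case\<close>). Then \<open>D y = z\<close>, \<open>D z = 0\<close> for some basis \<open>e, y, z\<close>,
    and few parameters survive.

  \<^item> \<open>D = 0\<close>, so that \<open>e\<close> is a two-sided identity. In the noncommutative case
    (\<open>unit_noncommutative_case\<close>) there are \<open>m, n\<close> independent of \<open>e\<close> with \<open>[m, n] = n\<close>. Left multiplication
    by \<open>n\<close> is then nilpotent, and the two cases differ by the length of the chain \<open>e, n, n \<cdot> n\<close>. In the
    commutative case (\<open>unit_commutative_case\<close>) the algebra is associative, and it is either
    generated by one element, hence a quotient of \<open>\<real>[X]\<close> by a cubic, or the
    square-zero extension of \<open>\<real>\<close> by a plane.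

  In each case the remaining structure constants are found by evaluating left symmetry on basis
  vectors, and a change of basis turns the multiplication table into one of the normal forms.

  For the converse statement, that every normal form is flat, multilinearity reduces the claim to
  products of basis vectors.
\<close>

section \<open>Products given by tables\<close>

lemma structure_product_expand:
  "structure_product [[a11,a12,a13],[a21,a22,a23],[a31,a32,a33]] x y =
     (x$1 * y$1) *\<^sub>R a11 + (x$1 * y$2) *\<^sub>R a12 + (x$1 * y$3) *\<^sub>R a13 +
     (x$2 * y$1) *\<^sub>R a21 + (x$2 * y$2) *\<^sub>R a22 + (x$2 * y$3) *\<^sub>R a23 +
     (x$3 * y$1) *\<^sub>R a31 + (x$3 * y$2) *\<^sub>R a32 + (x$3 * y$3) *\<^sub>R a33"
  by (simp add: structure_product_def sum_3 vector_3)

lemma bilinear_structure_product: "bilinear (structure_product t)"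
  unfolding bilinear_def structure_product_def
  by (auto intro!: linearI simp: algebra_simps sum.distrib scaleR_sum_right scaleR_add_left)

text \<open>
  The Jacobi identity is a consequence of flatness: the cyclic sum of the iterated brackets is the
  cyclic sum of the curvature terms.
\<close>
lemma flat_lie_algebraI:
  fixes br nab :: "'a::real_vector \<Rightarrow> 'a \<Rightarrow> 'a"
  assumes nab: "bilinear nab"
    and tor: "\<And>x y. nab x y - nab y x = br x y"
    and flat: "\<And>x y z. nab x (nab y z) - nab y (nab x z) - nab (nab x y - nab y x) z = 0"
  shows "flat_lie_algebra br nab"
proof -
  note bil = bilinear_ladd[OF nab] bilinear_radd[OF nab] bilinear_lmul[OF nab]
    bilinear_rmul[OF nab] bilinear_lsub[OF nab] bilinear_rsub[OF nab]
  have br: "br x y = nab x y - nab y x" for x y by (simp add: tor)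
  have "bilinear br" unfolding bilinear_def br
    by (auto intro!: linearI simp: bil algebra_simps)
  moreover have "br x (br y z) + br y (br z x) + br z (br x y) = 0" for x y z
  proof -
    have "br x (br y z) + br y (br z x) + br z (br x y) =
        (nab x (nab y z) - nab y (nab x z) - nab (nab x y - nab y x) z)
      + (nab y (nab z x) - nab z (nab y x) - nab (nab y z - nab z y) x)
      + (nab z (nab x y) - nab x (nab z y) - nab (nab z x - nab x z) y)"
      by (simp add: br bil algebra_simps)
    then show ?thesis by (simp only: flat add_0)
  qed
  ultimately show ?thesis
    unfolding flat_lie_algebra_def lie_algebra_def using nab flat by (simp add: br)
qed

text \<open>The curvature is trilinear.\<close>
lemma flat_on_basis:
  fixes nab :: "real^3 \<Rightarrow> real^3 \<Rightarrow> real^3"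
  assumes nab: "bilinear nab"
    and b: "\<And>i j k :: 3. nab (axis i 1) (nab (axis j 1) (axis k 1)) - nab (axis j 1) (nab (axis i 1) (axis k 1))
         - nab (nab (axis i 1) (axis j 1) - nab (axis j 1) (axis i 1)) (axis k 1) = 0"
  shows "nab x (nab y z) - nab y (nab x z) - nab (nab x y - nab y x) z = 0"
proof -
  note bil = bilinear_ladd[OF nab] bilinear_radd[OF nab] bilinear_lmul[OF nab]
    bilinear_rmul[OF nab] bilinear_lsub[OF nab] bilinear_rsub[OF nab]
  define T where "T x y z = nab x (nab y z) - nab y (nab x z) - nab (nab x y - nab y x) z" for x y z
  have ex: "v = (\<Sum>i\<in>UNIV. v$i *\<^sub>R axis i 1)" for v :: "real^3"
    using basis_expansion[of v] by (simp add: scalar_mult_eq_scaleR)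
  have "linear (\<lambda>z. T x y z)" "linear (\<lambda>y. T x y z)" "linear (\<lambda>x. T x y z)" for x y z
    unfolding T_def by (auto intro!: linearI simp: bil algebra_simps)
  note lin = this
  have "T x y z = (\<Sum>i\<in>UNIV. x$i *\<^sub>R (\<Sum>j\<in>UNIV. y$j *\<^sub>R (\<Sum>k\<in>UNIV. z$k *\<^sub>R T (axis i 1) (axis j 1) (axis k 1))))"
    apply (subst ex[of x], subst linear_sum[OF lin(3)], rule sum.cong[OF refl], subst linear_scale[OF lin(3)])
    apply (subst ex[of y], subst linear_sum[OF lin(2)], subst linear_scale[OF lin(2)])
    apply (subst ex[of z], subst linear_sum[OF lin(1)], subst linear_scale[OF lin(1)])
    apply simp
    done
  also have "\<dots> = 0" unfolding T_def by (simp add: b)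
  finally show ?thesis by (simp add: T_def)
qed

lemmas structure_product_bilinear =
  bilinear_ladd[OF bilinear_structure_product] bilinear_radd[OF bilinear_structure_product]
  bilinear_lmul[OF bilinear_structure_product] bilinear_rmul[OF bilinear_structure_product]
  bilinear_lsub[OF bilinear_structure_product] bilinear_rsub[OF bilinear_structure_product]
  bilinear_lneg[OF bilinear_structure_product] bilinear_rneg[OF bilinear_structure_product]
  bilinear_lzero[OF bilinear_structure_product] bilinear_rzero[OF bilinear_structure_product]
  bilinear_lzero[OF bilinear_structure_product] bilinear_rzero[OF bilinear_structure_product]

text \<open>
  Rules that settle equations between entries of tables. Quotients are split along sums in their
  numerators, so that every entry becomes a sum of monomials in the parameters and their inverses.
\<close>
lemmas entry_simps = algebra_simps add_divide_distrib diff_divide_distrib axis_def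

lemmas bracket_defs = lie_3g1_def lie_g21_g1_def lie_heisenberg_def lie_g32_def lie_g33_def lie_g34_def lie_g35_def

text \<open>The curvature is alternating in its first two arguments, so three pairs of basis vectors suffice.\<close>
lemma flat_on_basis_pairs:
  fixes nab :: "real^3 \<Rightarrow> real^3 \<Rightarrow> real^3"
  assumes nab: "bilinear nab"
    and b: "\<And>k. nab e1 (nab e2 (axis k 1)) - nab e2 (nab e1 (axis k 1)) - nab (nab e1 e2 - nab e2 e1) (axis k 1) = 0"
      "\<And>k. nab e1 (nab e3 (axis k 1)) - nab e3 (nab e1 (axis k 1)) - nab (nab e1 e3 - nab e3 e1) (axis k 1) = 0"
      "\<And>k. nab e2 (nab e3 (axis k 1)) - nab e3 (nab e2 (axis k 1)) - nab (nab e2 e3 - nab e3 e2) (axis k 1) = 0"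
  shows "nab x (nab y z) - nab y (nab x z) - nab (nab x y - nab y x) z = 0"
proof (rule flat_on_basis[OF nab])
  fix i j k :: 3
  have sw: "nab x (nab y z) - nab y (nab x z) - nab (nab x y - nab y x) z = 0"
    if "nab y (nab x z) - nab x (nab y z) - nab (nab y x - nab x y) z = 0" for x y z
    using that by (simp add: bilinear_lsub[OF nab] algebra_simps)
  show "nab (axis i 1) (nab (axis j 1) (axis k 1)) - nab (axis j 1) (nab (axis i 1) (axis k 1))
         - nab (nab (axis i 1) (axis j 1) - nab (axis j 1) (axis i 1)) (axis k 1) = 0"
    using exhaust_3[of i] exhaust_3[of j] b[of k] sw[OF b(1)[of k]] sw[OF b(2)[of k]] sw[OF b(3)[of k]]
    by (elim disjE) (simp_all add: bilinear_lzero[OF nab])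
qed

lemma structure_product_basis:
  fixes a11 :: "real^3"
  shows
  "structure_product [[a11,a12,a13],[a21,a22,a23],[a31,a32,a33]] e1 e1 = a11"
  "structure_product [[a11,a12,a13],[a21,a22,a23],[a31,a32,a33]] e1 e2 = a12"
  "structure_product [[a11,a12,a13],[a21,a22,a23],[a31,a32,a33]] e1 e3 = a13"
  "structure_product [[a11,a12,a13],[a21,a22,a23],[a31,a32,a33]] e2 e1 = a21"
  "structure_product [[a11,a12,a13],[a21,a22,a23],[a31,a32,a33]] e2 e2 = a22"
  "structure_product [[a11,a12,a13],[a21,a22,a23],[a31,a32,a33]] e2 e3 = a23"
  "structure_product [[a11,a12,a13],[a21,a22,a23],[a31,a32,a33]] e3 e1 = a31"
  "structure_product [[a11,a12,a13],[a21,a22,a23],[a31,a32,a33]] e3 e2 = a32"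
  "structure_product [[a11,a12,a13],[a21,a22,a23],[a31,a32,a33]] e3 e3 = a33"
  by (simp_all add: structure_product_expand axis_def)

section \<open>The normal forms are flat with the stated right identity\<close>

lemma model_right_identity: "model br nab e \<Longrightarrow> right_identity nab e"
  by (erule model.cases;
    simp add: right_identity_def structure_product_expand vec_eq_iff forall_3 entry_simps)

lemma model_torsion_free: "model br nab e \<Longrightarrow> nab x y - nab y x = br x y"
  by (erule model.cases;
    simp add: bracket_defs structure_product_expand vec_eq_iff forall_3 entry_simps)

lemma model_flat_on_basis:
  "model br nab e \<Longrightarrow> z \<in> {e1,e2,e3} \<Longrightarrow>
   nab e1 (nab e2 z) - nab e2 (nab e1 z) - nab (nab e1 e2 - nab e2 e1) z = 0 \<and>
   nab e1 (nab e3 z) - nab e3 (nab e1 z) - nab (nab e1 e3 - nab e3 e1) z = 0 \<and>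
   nab e2 (nab e3 z) - nab e3 (nab e2 z) - nab (nab e2 e3 - nab e3 e2) z = 0"
  by (erule model.cases; elim insertE emptyE;
    simp add: structure_product_basis structure_product_bilinear;
    simp add: vec_eq_iff forall_3 entry_simps)

lemma model_flat_lie_algebra: assumes "model br nab e" shows "flat_lie_algebra br nab"
proof (rule flat_lie_algebraI)
  show bil: "bilinear nab" using assms by (cases rule: model.cases) (simp_all only: bilinear_structure_product)
  show "nab x y - nab y x = br x y" for x y by (rule model_torsion_free[OF assms])
  show "nab x (nab y z) - nab y (nab x z) - nab (nab x y - nab y x) z = 0" for x y z
  proof (rule flat_on_basis_pairs[OF bil])
    fix k :: 3
    have "axis k 1 \<in> {e1, e2, e3}" using exhaust_3[of k] by auto
    from model_flat_on_basis[OF assms this]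
    show "nab e1 (nab e2 (axis k 1)) - nab e2 (nab e1 (axis k 1)) - nab (nab e1 e2 - nab e2 e1) (axis k 1) = 0"
      "nab e1 (nab e3 (axis k 1)) - nab e3 (nab e1 (axis k 1)) - nab (nab e1 e3 - nab e3 e1) (axis k 1) = 0"
      "nab e2 (nab e3 (axis k 1)) - nab e3 (nab e2 (axis k 1)) - nab (nab e2 e3 - nab e3 e2) (axis k 1) = 0"
      by simp_all
  qed
qed

section \<open>Coordinates in a three-dimensional space\<close>

text \<open>
  Linear combinations are kept behind a constant, so that the simplifier computes with
  coordinate triples and never with sums of scaled vectors.
\<close>
definition comb :: "'a::real_vector \<Rightarrow> 'a \<Rightarrow> 'a \<Rightarrow> real \<Rightarrow> real \<Rightarrow> real \<Rightarrow> 'a" where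
  "comb u v w a b c = a *\<^sub>R u + b *\<^sub>R v + c *\<^sub>R w"

definition indep3 :: "'a::real_vector \<Rightarrow> 'a \<Rightarrow> 'a \<Rightarrow> bool" where
  "indep3 u v w \<longleftrightarrow> (\<forall>a b c. comb u v w a b c = 0 \<longrightarrow> a = 0 \<and> b = 0 \<and> c = 0)"

lemma comb_add: "comb u v w a b c + comb u v w a' b' c' = comb u v w (a + a') (b + b') (c + c')"
  and comb_diff: "comb u v w a b c - comb u v w a' b' c' = comb u v w (a - a') (b - b') (c - c')"
  and comb_scale: "r *\<^sub>R comb u v w a b c = comb u v w (r * a) (r * b) (r * c)"
  and comb_minus: "- comb u v w a b c = comb u v w (- a) (- b) (- c)"
  and comb_zero: "comb u v w 0 0 0 = 0"
  and comb_1: "comb u v w 1 0 0 = u"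
  and comb_2: "comb u v w 0 1 0 = v"
  and comb_3: "comb u v w 0 0 1 = w"
  by (simp_all add: comb_def algebra_simps)

text \<open>Change of basis, with the coordinates of the new basis vectors as rows.\<close>
lemma comb_comb:
  "comb (comb u v w a1 b1 c1) (comb u v w a2 b2 c2) (comb u v w a3 b3 c3) p q r =
   comb u v w (p * a1 + q * a2 + r * a3) (p * b1 + q * b2 + r * b3) (p * c1 + q * c2 + r * c3)"
  by (simp add: comb_def algebra_simps)

lemma comb_eq_iff:
  assumes "indep3 u v w"
  shows "comb u v w a b c = comb u v w a' b' c' \<longleftrightarrow> a = a' \<and> b = b' \<and> c = c'"
proof
  assume "comb u v w a b c = comb u v w a' b' c'"
  then have "comb u v w (a - a') (b - b') (c - c') = 0" by (simp flip: comb_diff)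
  with assms show "a = a' \<and> b = b' \<and> c = c'" unfolding indep3_def by fastforce
qed simp

lemma comb_eq_0_iff:
  assumes "indep3 u v w"
  shows "comb u v w a b c = 0 \<longleftrightarrow> a = 0 \<and> b = 0 \<and> c = 0"
  using comb_eq_iff[OF assms, of a b c 0 0 0] by (simp add: comb_zero)

text \<open>Cramer's rule: each coefficient of a vanishing combination is annihilated by the determinant.\<close>
lemma indep3_comb:
  assumes ind: "indep3 u v w"
    and det: "pa * (qb * rc - rb * qc) - qa * (pb * rc - rb * pc) + ra * (pb * qc - qb * pc) \<noteq> 0"
  shows "indep3 (comb u v w pa pb pc) (comb u v w qa qb qc) (comb u v w ra rb rc)"
proof -
  let ?d = "pa * (qb * rc - rb * qc) - qa * (pb * rc - rb * pc) + ra * (pb * qc - qb * pc)"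
  have "x = 0 \<and> y = 0 \<and> z = 0"
    if "x * pa + y * qa + z * ra = 0" "x * pb + y * qb + z * rb = 0" "x * pc + y * qc + z * rc = 0"
    for x y z
  proof -
    have "x * ?d = 0" "y * ?d = 0" "z * ?d = 0" using that by algebra+
    with det show ?thesis by simp
  qed
  then show ?thesis
    unfolding indep3_def[of "comb u v w pa pb pc"] comb_comb comb_eq_0_iff[OF ind] by blast
qed

lemma indep3_replace:
  assumes "indep3 u v w" and "qb * rc \<noteq> rb * qc"
  shows "indep3 u (comb u v w qa qb qc) (comb u v w ra rb rc)"
  using indep3_comb[OF assms(1), where pa = 1 and pb = 0 and pc = 0] assms(2) by (simp add: comb_1)

text \<open>A vector outside the span would make four independent vectors in a space of dimension three.\<close>
lemma indep3_spans:
  fixes u v w :: "'a::real_vector"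
  assumes dim3: "dim (UNIV :: 'a set) = 3" and ind: "indep3 u v w"
  obtains a b c where "z = comb u v w a b c"
proof -
  obtain B :: "'a set" where B: "independent B" "span B = UNIV" "card B = 3"
    using dim3 basis_exists[of "UNIV :: 'a set"] by (metis top.extremum_uniqueI)
  have finB: "finite B" using B(3) card.infinite by fastforce
  have ne: "u \<noteq> v" "u \<noteq> w" "v \<noteq> w"
    using ind comb_eq_0_iff[OF ind, of 1 "-1" 0] comb_eq_0_iff[OF ind, of 1 0 "-1"]
      comb_eq_0_iff[OF ind, of 0 1 "-1"] by (auto simp: comb_def)
  have ind': "independent {u, v, w}"
  proof -
    have "(\<Sum>x\<in>{u,v,w}. f x *\<^sub>R x) = 0 \<Longrightarrow> x \<in> {u,v,w} \<Longrightarrow> f x = 0" for f :: "'a \<Rightarrow> real" and x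
      using ne comb_eq_0_iff[OF ind, of "f u" "f v" "f w"] by (auto simp: comb_def add.assoc)
    then show ?thesis by (rule independent_if_scalars_zero[rotated]; simp)
  qed
  have "z \<in> span {u, v, w}"
  proof (rule ccontr)
    assume z: "z \<notin> span {u, v, w}"
    then have "independent (insert z {u, v, w})" using ind' by (simp add: independent_insert)
    then have "card (insert z {u, v, w}) \<le> card B"
      using independent_span_bound[OF finB] B(2) by auto
    moreover have "z \<notin> {u, v, w}" using z by (auto intro: span_base)
    ultimately show False using ne B(3) by simp
  qed
  then obtain a b c where "z - a *\<^sub>R u - b *\<^sub>R v = c *\<^sub>R w"
    by (auto simp: span_breakdown_eq span_singleton)
  then have "z = comb u v w a b c" by (simp add: comb_def algebra_simps)
  then show thesis by (rule that)
qed

section \<open>Left-symmetric algebras with a right identity\<close>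

locale flat_algebra3 =
  fixes mul :: "'a::real_vector \<Rightarrow> 'a \<Rightarrow> 'a" (infixl "\<cdot>" 70) and e :: 'a
  assumes bil: "bilinear mul"
    and left_symmetric: "x \<cdot> (y \<cdot> z) - y \<cdot> (x \<cdot> z) = (x \<cdot> y - y \<cdot> x) \<cdot> z"
    and right_id: "x \<cdot> e = x"
    and dim3: "dim (UNIV :: 'a set) = 3"
begin

lemmas bil_simps = bilinear_ladd[OF bil] bilinear_radd[OF bil] bilinear_lmul[OF bil]
  bilinear_rmul[OF bil] bilinear_lsub[OF bil] bilinear_rsub[OF bil]
  bilinear_lneg[OF bil] bilinear_rneg[OF bil] bilinear_lzero[OF bil] bilinear_rzero[OF bil]

text \<open>
  A form without differences: after expansion in a basis both sides are linear combinations with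
  explicit coordinates, which can be compared entry by entry.
\<close>
lemma left_symmetric': "x \<cdot> (y \<cdot> z) + (y \<cdot> x) \<cdot> z = y \<cdot> (x \<cdot> z) + (x \<cdot> y) \<cdot> z"
  using left_symmetric[of x y z] by (simp add: bil_simps algebra_simps)

lemma mul_comb_left: "comb u v w a b c \<cdot> z = a *\<^sub>R (u \<cdot> z) + b *\<^sub>R (v \<cdot> z) + c *\<^sub>R (w \<cdot> z)"
  and mul_comb_right: "z \<cdot> comb u v w a b c = a *\<^sub>R (z \<cdot> u) + b *\<^sub>R (z \<cdot> v) + c *\<^sub>R (z \<cdot> w)"
  by (simp_all add: comb_def bil_simps)

lemmas coords = comb_add comb_diff comb_scale comb_minus mul_comb_left mul_comb_right comb_comb

lemmas indep3_obtain = indep3_spans[OF dim3]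

text \<open>
  To recognise a normal form it suffices to exhibit a basis with the right multiplication table. The
  new basis is given by its coordinates in an old one \<open>u, v, w\<close> whose products are known; the
  isomorphism is the coordinate map of the new basis.
\<close>
lemma flat_isomorphic_structure_product:
  assumes ind: "indep3 u v w"
    and det: "pa * (qb * rc - rb * qc) - qa * (pb * rc - rb * pc) + ra * (pb * qc - qb * pc) \<noteq> 0"
    and f: "f1 = comb u v w pa pb pc" "f2 = comb u v w qa qb qc" "f3 = comb u v w ra rb rc"
    and m: "f1 \<cdot> f1 = comb f1 f2 f3 (t11$1) (t11$2) (t11$3)"
      "f1 \<cdot> f2 = comb f1 f2 f3 (t12$1) (t12$2) (t12$3)"
      "f1 \<cdot> f3 = comb f1 f2 f3 (t13$1) (t13$2) (t13$3)"
      "f2 \<cdot> f1 = comb f1 f2 f3 (t21$1) (t21$2) (t21$3)"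
      "f2 \<cdot> f2 = comb f1 f2 f3 (t22$1) (t22$2) (t22$3)"
      "f2 \<cdot> f3 = comb f1 f2 f3 (t23$1) (t23$2) (t23$3)"
      "f3 \<cdot> f1 = comb f1 f2 f3 (t31$1) (t31$2) (t31$3)"
      "f3 \<cdot> f2 = comb f1 f2 f3 (t32$1) (t32$2) (t32$3)"
      "f3 \<cdot> f3 = comb f1 f2 f3 (t33$1) (t33$2) (t33$3)"
  shows "flat_isomorphic mul (structure_product [[t11,t12,t13],[t21,t22,t23],[t31,t32,t33]])"
proof -
  define \<phi> where "\<phi> x = comb f1 f2 f3 (x$1) (x$2) (x$3)" for x :: "real^3"
  let ?P = "structure_product [[t11,t12,t13],[t21,t22,t23],[t31,t32,t33]]"
  have indf: "indep3 f1 f2 f3" unfolding f by (rule indep3_comb[OF ind det])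
  have lin: "linear \<phi>" unfolding \<phi>_def by (rule linearI) (simp_all add: comb_add comb_scale)
  have inj: "inj \<phi>" unfolding \<phi>_def by (rule injI) (simp add: comb_eq_iff[OF indf] vec_eq_iff forall_3)
  have "\<exists>x. \<phi> x = z" for z
  proof -
    obtain a b c where "z = comb f1 f2 f3 a b c" by (rule indep3_obtain[OF indf])
    then have "\<phi> (vector [a, b, c]) = z" by (simp add: \<phi>_def vector_3)
    then show ?thesis ..
  qed
  then have surj: "surj \<phi>" by (metis surj_def)
  have hom: "\<phi> (?P x y) = \<phi> x \<cdot> \<phi> y" for x y
    unfolding \<phi>_def structure_product_expand mul_comb_left mul_comb_right m
    by (simp add: coords algebra_simps)
  have inv: "\<phi> (inv \<phi> z) = z" for z using surj by (simp add: surj_f_inv_f)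
  have "linear (inv \<phi>)"
    by (rule linearI; rule injD[OF inj]; simp add: inv linear_add[OF lin] linear_scale[OF lin])
  moreover have "bij (inv \<phi>)" using inj surj by (simp add: bij_imp_bij_inv bijI)
  moreover have "inv \<phi> (x \<cdot> y) = ?P (inv \<phi> x) (inv \<phi> y)" for x y
    by (rule injD[OF inj]) (simp add: inv hom)
  ultimately show ?thesis unfolding flat_isomorphic_def by blast
qed

abbreviation classified :: bool where
  "classified \<equiv> \<exists>br' nab' e'. model br' nab' e' \<and> flat_isomorphic mul nab'"

lemma classifiedI: "model br' nab' e' \<Longrightarrow> flat_isomorphic mul nab' \<Longrightarrow> classified"
  by blast

lemmas table_iso = flat_isomorphic_structure_product[OF _ _ refl refl refl]

text \<open>
  Suppose \<open>D x = e\<close>, where \<open>D z = e \<cdot> z - z\<close>. As \<open>D\<close> is a derivation, \<open>D (x \<cdot> x) = 2 x + e\<close>, so that \<open>e, x, x \<cdot> x\<close> is a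
  basis and the image of \<open>D\<close> is spanned by \<open>e\<close> and \<open>x\<close>. But then \<open>D (x \<cdot> (x \<cdot> x))\<close> has the
  coefficient \<open>3\<close> at \<open>x \<cdot> x\<close>.
\<close>
lemma not_in_image:
  assumes "e \<noteq> 0"
  shows "e \<cdot> x - x \<noteq> e"
proof
  assume "e \<cdot> x - x = e"
  then have x: "e \<cdot> x = e + x" by (simp add: algebra_simps)
  have D: "e \<cdot> (y \<cdot> z) = (e \<cdot> y) \<cdot> z + y \<cdot> (e \<cdot> z) - y \<cdot> z" for y z
    using left_symmetric[of e y z] by (simp add: right_id bil_simps algebra_simps)
  define y where "y = x \<cdot> x"
  have y: "e \<cdot> y = e + 2 *\<^sub>R x + y"
    unfolding y_def D x by (simp add: x bil_simps right_id algebra_simps scaleR_2)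
  have ind: "indep3 e x y"
    unfolding indep3_def
  proof (intro allI impI)
    fix a b c assume 0: "comb e x y a b c = 0"
    define d where "d z = e \<cdot> z - z" for z
    have d: "d (comb e x y a b c) = comb e x y (b + c) (2 * c) 0" for a b c
      unfolding d_def by (simp add: comb_def bil_simps right_id x y algebra_simps)
    have d0: "d 0 = 0" by (simp add: d_def bil_simps)
    have "d (d (comb e x y a b c)) = 0" using 0 d0 by simp
    then have "c = 0" using assms unfolding d by (simp add: comb_def)
    moreover have "d (comb e x y a b c) = 0" using 0 d0 by simp
    ultimately have "b = 0" using assms unfolding d by (simp add: comb_def)
    with 0 \<open>c = 0\<close> assms show "a = 0 \<and> b = 0 \<and> c = 0" by (simp add: comb_def)
  qed
  obtain p q r where xy: "x \<cdot> y = comb e x y p q r" by (rule indep3_obtain[OF ind])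
  have T: "e \<cdot> e = comb e x y 1 0 0" "e \<cdot> x = comb e x y 1 1 0" "e \<cdot> y = comb e x y 1 2 1"
    "x \<cdot> e = comb e x y 0 1 0" "y \<cdot> e = comb e x y 0 0 1" "x \<cdot> x = comb e x y 0 0 1"
    using y by (simp_all add: right_id x comb_def y_def)
  from D[of x y] show False by (simp add: T xy coords comb_eq_iff[OF ind])
qed

section \<open>Two nonzero eigenvalues of the derivation\<close>

text \<open>
  If \<open>D x = l x\<close> and \<open>D y = m y\<close>, then \<open>x \<cdot> x\<close>, \<open>y \<cdot> y\<close> and the mixed products are zero or
  eigenvectors for \<open>2 l\<close>, \<open>2 m\<close> and \<open>l + m\<close>. As \<open>\<bar>m\<bar> \<le> \<bar>l\<bar>\<close>, \<open>x \<cdot> x\<close> vanishes, and \<open>y \<cdot> y\<close> is a multiple of \<open>x\<close>,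
  nonzero only if \<open>l = 2 m\<close>. Mixed products could be multiples of \<open>e\<close> when
  \<open>l + m = 0\<close>, and left symmetry on \<open>x, y, x\<close> and \<open>y, x, y\<close> excludes this. In the models
  \<open>e = \<gamma> e\<^sub>3\<close> with \<open>[e\<^sub>3, e\<^sub>1] = - e\<^sub>1\<close>, whence \<open>\<gamma> = - l\<close>; when \<open>m = - l\<close> the two eigenvectors may be
  exchanged to make the parameter positive.
\<close>
lemma diagonal_case:
  assumes ind: "indep3 e x y" and l: "l \<noteq> 0" and m: "m \<noteq> 0" and le: "\<bar>m\<bar> \<le> \<bar>l\<bar>"
    and ex: "e \<cdot> x = (1 + l) *\<^sub>R x" and ey: "e \<cdot> y = (1 + m) *\<^sub>R y"
  shows classified
proof -
  obtain a1 b1 c1 where xx: "x \<cdot> x = comb e x y a1 b1 c1" by (rule indep3_obtain[OF ind])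
  obtain a2 b2 c2 where xy: "x \<cdot> y = comb e x y a2 b2 c2" by (rule indep3_obtain[OF ind])
  obtain a3 b3 c3 where yx: "y \<cdot> x = comb e x y a3 b3 c3" by (rule indep3_obtain[OF ind])
  obtain a4 b4 c4 where yy: "y \<cdot> y = comb e x y a4 b4 c4" by (rule indep3_obtain[OF ind])
  have T: "e \<cdot> e = comb e x y 1 0 0" "x \<cdot> e = comb e x y 0 1 0" "y \<cdot> e = comb e x y 0 0 1"
    "e \<cdot> x = comb e x y 0 (1 + l) 0" "e \<cdot> y = comb e x y 0 0 (1 + m)"
    by (simp_all add: right_id ex ey comb_def)
  note S = T xx xy yx yy coords comb_eq_iff[OF ind] comb_eq_0_iff[OF ind]
  have "m * c1 = 2 * l * c1" "a1 = 0" "b1 = 0"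
    using left_symmetric'[of e x x] l by (simp_all add: S algebra_simps)
  moreover have "m \<noteq> 2 * l" using le l by auto
  ultimately have 1: "a1 = 0" "b1 = 0" "c1 = 0" by auto
  have 2: "(l + m) * a2 = 0" "b2 = 0" "c2 = 0"
    using left_symmetric'[of e x y] l m by (simp_all add: S algebra_simps)
  have 3: "(l + m) * a3 = 0" "b3 = 0" "c3 = 0"
    using left_symmetric'[of e y x] l m by (simp_all add: S algebra_simps)
  have 4: "a4 = 0" "l * b4 = 2 * m * b4" "c4 = 0"
    using left_symmetric'[of e y y] m by (simp_all add: S algebra_simps)
  have 5: "a2 = 0 \<and> a3 = 0"
  proof (cases "l + m = 0")
    case True
    then have m: "m = - l" by simp
    have "b4 = 0" using 4 m l by simp
    then have "a3 = (a2 - a3) * (1 + l)" "a2 = (a3 - a2) * (1 + m)"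
      using left_symmetric'[of x y x] left_symmetric'[of y x y] 1 2 3 4 by (simp_all add: S algebra_simps)
    then have "3 * (a2 - a3) = 0" unfolding m by algebra
    then have "a2 = a3" by simp
    with \<open>a2 = (a3 - a2) * (1 + m)\<close> show ?thesis by simp
  qed (use 2 3 in auto)
  note S' = S 1 2(2,3) 3(2,3) 4(1,3) 5[THEN conjunct1] 5[THEN conjunct2]
  show ?thesis
  proof (cases "b4 = 0")
    case False
    with 4 have lm: "l = 2 * m" by simp
    show ?thesis
      apply (rule classifiedI[OF h20[of "-l"]])
      using l apply simp
      apply (rule table_iso[where pa = 0 and pb = b4 and pc = 0 and qa = 0 and qb = 0 and qc = 1
          and ra = "-1/l" and rb = 0 and rc = 0, OF ind])
      by (simp_all add: S' False lm m entry_simps)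
  next
    case b4: True
    have "\<bar>m / l\<bar> \<le> 1" using le l by (simp add: abs_divide)
    then consider "m = l" | "m = -l" "l < 0" | "m = -l" "l > 0" | "\<bar>m / l\<bar> < 1"
      using l by (cases "\<bar>m / l\<bar> = 1"; simp add: abs_divide abs_eq_iff) force+
    then show ?thesis
    proof cases
      case 1
      show ?thesis
        apply (rule classifiedI[OF h18[of "-l"]])
        using l apply simp
        apply (rule table_iso[where pa = 0 and pb = 1 and pc = 0 and qa = 0 and qb = 0 and qc = 1
          and ra = "-1/l" and rb = 0 and rc = 0, OF ind])
        by (simp_all add: S' b4 1 l entry_simps)
    next
      case 2
      show ?thesis
        apply (rule classifiedI[OF h21[of "-l"]])
        using 2 apply simp
        apply (rule table_iso[where pa = 0 and pb = 1 and pc = 0 and qa = 0 and qb = 0 and qc = 1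
          and ra = "-1/l" and rb = 0 and rc = 0, OF ind])
        by (simp_all add: S' b4 2 l entry_simps)
    next
      case 3
      show ?thesis
        apply (rule classifiedI[OF h21[of "l"]])
        using 3 apply simp
        apply (rule table_iso[where pa = 0 and pb = 0 and pc = 1 and qa = 0 and qb = 1 and qc = 0
          and ra = "1/l" and rb = 0 and rc = 0, OF ind])
        by (simp_all add: S' b4 3 l entry_simps)
    next
      case 4
      show ?thesis
        apply (rule classifiedI[OF h19[of "m/l" "-l"]])
        using 4 l m apply simp_all[3]
        apply (rule table_iso[where pa = 0 and pb = 1 and pc = 0 and qa = 0 and qb = 0 and qc = 1
          and ra = "-1/l" and rb = 0 and rc = 0, OF ind])
        by (simp_all add: S' b4 l m entry_simps)
    qed
  qed
qed

text \<open>
  Products of vectors of the plane lie in the generalised eigenspace of \<open>D\<close> for \<open>2 l\<close>, which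
  is zero because the eigenvalues of \<open>D\<close> are \<open>0\<close> and \<open>l\<close>.
\<close>
lemma jordan_case:
  assumes ind: "indep3 e x y" and l: "l \<noteq> 0"
    and ex: "e \<cdot> x = (1 + l) *\<^sub>R x" and ey: "e \<cdot> y = (1 + l) *\<^sub>R y + x"
  shows classified
proof -
  obtain a1 b1 c1 where xx: "x \<cdot> x = comb e x y a1 b1 c1" by (rule indep3_obtain[OF ind])
  obtain a2 b2 c2 where xy: "x \<cdot> y = comb e x y a2 b2 c2" by (rule indep3_obtain[OF ind])
  obtain a3 b3 c3 where yx: "y \<cdot> x = comb e x y a3 b3 c3" by (rule indep3_obtain[OF ind])
  obtain a4 b4 c4 where yy: "y \<cdot> y = comb e x y a4 b4 c4" by (rule indep3_obtain[OF ind])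
  have T: "e \<cdot> e = comb e x y 1 0 0" "x \<cdot> e = comb e x y 0 1 0" "y \<cdot> e = comb e x y 0 0 1"
    "e \<cdot> x = comb e x y 0 (1 + l) 0" "e \<cdot> y = comb e x y 0 1 (1 + l)"
    by (simp_all add: right_id ex ey comb_def)
  note S = T xx xy yx yy coords comb_eq_iff[OF ind] comb_eq_0_iff[OF ind]
  have 1: "a1 = 0" "c1 = 0" "b1 = 0"
    using left_symmetric'[of e x x] l by (auto simp: S algebra_simps)
  have 2: "a2 = 0" "c2 = 0" "b2 = 0"
    using left_symmetric'[of e x y] l 1 by (auto simp: S algebra_simps)
  have 3: "a3 = 0" "c3 = 0" "b3 = 0"
    using left_symmetric'[of e y x] l 1 by (auto simp: S algebra_simps)
  have 4: "a4 = 0" "c4 = 0" "b4 = 0"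
    using left_symmetric'[of e y y] l 1 2 3 by (auto simp: S algebra_simps)
  show ?thesis
    apply (rule classifiedI[OF h17[of "-l"]])
    using l apply simp
    apply (rule table_iso[where pa = 0 and pb = "1/l" and pc = 0 and qa = 0 and qb = 0 and qc = 1
      and ra = "-1/l" and rb = 0 and rc = 0, OF ind])
    by (simp_all add: S 1 2 3 4 l entry_simps)
qed

text \<open>
  On the plane of \<open>x, y\<close> the derivation is \<open>p\<close> plus \<open>q\<close> times a rotation by a right angle. The bilinear maps
  from this plane to itself that commute with \<open>D\<close> form the kernel of \<open>p\<close> plus \<open>q\<close> times a skew matrix with
  eigenvalues \<open>\<plusminus>i, \<plusminus>3i\<close>, and this kernel is zero as \<open>q \<noteq> 0\<close>. Components along \<open>e\<close> survive
  only for \<open>p = 0\<close>, and then left symmetry on \<open>x, y, x\<close> excludes them.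
\<close>
lemma rotation_case:
  assumes ind: "indep3 e x y" and q: "q \<noteq> 0"
    and ex: "e \<cdot> x = (1 + p) *\<^sub>R x + q *\<^sub>R y" and ey: "e \<cdot> y = (1 + p) *\<^sub>R y - q *\<^sub>R x"
  shows classified
proof -
  obtain a1 b1 c1 where xx: "x \<cdot> x = comb e x y a1 b1 c1" by (rule indep3_obtain[OF ind])
  obtain a2 b2 c2 where xy: "x \<cdot> y = comb e x y a2 b2 c2" by (rule indep3_obtain[OF ind])
  obtain a3 b3 c3 where yx: "y \<cdot> x = comb e x y a3 b3 c3" by (rule indep3_obtain[OF ind])
  obtain a4 b4 c4 where yy: "y \<cdot> y = comb e x y a4 b4 c4" by (rule indep3_obtain[OF ind])
  have T: "e \<cdot> e = comb e x y 1 0 0" "x \<cdot> e = comb e x y 0 1 0" "y \<cdot> e = comb e x y 0 0 1"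
    "e \<cdot> x = comb e x y 0 (1 + p) q" "e \<cdot> y = comb e x y 0 (- q) (1 + p)"
    by (simp_all add: right_id ex ey comb_def)
  note S = T xx xy yx yy coords comb_eq_iff[OF ind] comb_eq_0_iff[OF ind]
  have 1: "2 * p * a1 + q * (a2 + a3) = 0" "- q * c1 = p * b1 + q * (b2 + b3)" "q * b1 = p * c1 + q * (c2 + c3)"
    using left_symmetric'[of e x x] by (auto simp: S algebra_simps)
  have 2: "2 * p * a2 + q * (a4 - a1) = 0" "- q * c2 = p * b2 + q * (b4 - b1)" "q * b2 = p * c2 + q * (c4 - c1)"
    using left_symmetric'[of e x y] by (auto simp: S algebra_simps)
  have 3: "2 * p * a3 + q * (a4 - a1) = 0" "- q * c3 = p * b3 + q * (b4 - b1)" "q * b3 = p * c3 + q * (c4 - c1)"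
    using left_symmetric'[of e y x] by (auto simp: S algebra_simps)
  have 4: "2 * p * a4 - q * (a2 + a3) = 0" "- q * c4 = p * b4 - q * (b2 + b3)" "q * b4 = p * c4 - q * (c2 + c3)"
    using left_symmetric'[of e y y] by (auto simp: S algebra_simps)
  have zb: "b1 = 0 \<and> b2 = 0 \<and> b3 = 0 \<and> b4 = 0 \<and> c1 = 0 \<and> c2 = 0 \<and> c3 = 0 \<and> c4 = 0"
  proof (cases "p = 0")
    case True
    have "q * (c1 + (b2 + b3)) = 0" "q * (b1 - (c2 + c3)) = 0" "q * (c2 + (b4 - b1)) = 0"
      "q * (b2 - (c4 - c1)) = 0" "q * (c3 + (b4 - b1)) = 0" "q * (b3 - (c4 - c1)) = 0"
      "q * (c4 - (b2 + b3)) = 0" "q * (b4 + (c2 + c3)) = 0"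
      using 1(2,3) 2(2,3) 3(2,3) 4(2,3) unfolding True distrib_left right_diff_distrib mult_zero_left mult_minus_left
      by linarith+
    then have "c1 + (b2 + b3) = 0" "b1 - (c2 + c3) = 0" "c2 + (b4 - b1) = 0"
      "b2 - (c4 - c1) = 0" "c3 + (b4 - b1) = 0" "b3 - (c4 - c1) = 0"
      "c4 - (b2 + b3) = 0" "b4 + (c2 + c3) = 0"
      using q by simp_all
    then show ?thesis by auto
  next
    case False
    have eqs: "p * b1 = - q * c1 - q * (b2 + b3)" "p * c1 = q * b1 - q * (c2 + c3)"
      "p * b2 = - q * c2 - q * (b4 - b1)" "p * c2 = q * b2 - q * (c4 - c1)"
      "p * b3 = - q * c3 - q * (b4 - b1)" "p * c3 = q * b3 - q * (c4 - c1)"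
      "p * b4 = - q * c4 + q * (b2 + b3)" "p * c4 = q * b4 + q * (c2 + c3)"
      using 1(2,3) 2(2,3) 3(2,3) 4(2,3) by simp_all
    \<comment> \<open>The part of the system proportional to \<open>q\<close> is skew, so it drops out of the scalar product of the
      system with the vector of unknowns.\<close>
    have "p * (b1*b1 + b2*b2 + b3*b3 + b4*b4 + c1*c1 + c2*c2 + c3*c3 + c4*c4) =
      (p * b1) * b1 + (p * b2) * b2 + (p * b3) * b3 + (p * b4) * b4 +
      (p * c1) * c1 + (p * c2) * c2 + (p * c3) * c3 + (p * c4) * c4"
      by (simp add: algebra_simps)
    also have "\<dots> = 0" unfolding eqs by (simp add: algebra_simps)
    finally have "p * (b1*b1 + b2*b2 + b3*b3 + b4*b4 + c1*c1 + c2*c2 + c3*c3 + c4*c4) = 0" .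
    then have "b1*b1 + b2*b2 + b3*b3 + b4*b4 + c1*c1 + c2*c2 + c3*c3 + c4*c4 = 0" using False by simp
    then show ?thesis by (auto simp: add_nonneg_eq_0_iff)
  qed
  have za: "a1 = 0 \<and> a2 = 0 \<and> a3 = 0 \<and> a4 = 0"
  proof (cases "p = 0")
    case True
    then have "a3 = - a2" "a4 = a1" using 1(1) 2(1) q by auto
    moreover have "a3 = 2 * a2" "- a1 = 2 * a2 * q"
      using left_symmetric'[of x y x] True zb \<open>a3 = - a2\<close> by (auto simp: S algebra_simps)
    ultimately show ?thesis by auto
  next
    case False
    have eqs: "2 * p * a1 = - q * (a2 + a3)" "2 * p * a2 = - q * (a4 - a1)"
      "2 * p * a3 = - q * (a4 - a1)" "2 * p * a4 = q * (a2 + a3)"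
      using 1(1) 2(1) 3(1) 4(1) by simp_all
    have "2 * (p * (a1*a1 + a2*a2 + a3*a3 + a4*a4)) =
      (2 * p * a1) * a1 + (2 * p * a2) * a2 + (2 * p * a3) * a3 + (2 * p * a4) * a4"
      by (simp add: algebra_simps)
    also have "\<dots> = 0" unfolding eqs by (simp add: algebra_simps)
    finally have "p * (a1*a1 + a2*a2 + a3*a3 + a4*a4) = 0" by simp
    then have "a1*a1 + a2*a2 + a3*a3 + a4*a4 = 0" using False by simp
    then show ?thesis by (auto simp: add_nonneg_eq_0_iff)
  qed
  have Z: "a1 = 0" "a2 = 0" "a3 = 0" "a4 = 0" "b1 = 0" "b2 = 0" "b3 = 0" "b4 = 0"
    "c1 = 0" "c2 = 0" "c3 = 0" "c4 = 0" using za zb by auto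
  note S' = S Z
  \<comment> \<open>Exchanging \<open>x\<close> and \<open>y\<close> changes the sign of \<open>q\<close>, hence of \<open>b\<close>, which must be nonnegative.\<close>
  define b where "b = - p / q"
  have p: "p = - b * q" using q by (simp add: b_def)
  note direct = table_iso[where pa = 0 and pb = 1 and pc = 0 and qa = 0 and qb = 0 and qc = 1
      and ra = "1/q" and rb = 0 and rc = 0, OF ind]
  note swapped = table_iso[where pa = 0 and pb = 0 and pc = 1 and qa = 0 and qb = 1 and qc = 0
      and ra = "-1/q" and rb = 0 and rc = 0, OF ind]
  consider "b > 0" | "b < 0" | "b = 0" "q > 0" | "b = 0" "q < 0" using q by linarith
  then show ?thesis
  proof cases
    case 1
    show ?thesis
      apply (rule classifiedI[OF h22[OF 1 q]])
      apply (rule direct)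
      by (simp_all add: S' p q entry_simps)
  next
    case 2
    show ?thesis
      apply (rule classifiedI[OF h22[of "-b" "-q"]])
      using 2 q apply simp_all[2]
      apply (rule swapped)
      by (simp_all add: S' p q entry_simps)
  next
    case 3
    show ?thesis
      apply (rule classifiedI[OF h23[of "q"]])
      using 3 q apply simp
      apply (rule direct)
      by (simp_all add: S' p q 3 entry_simps)
  next
    case 4
    show ?thesis
      apply (rule classifiedI[OF h23[of "-q"]])
      using 4 q apply simp
      apply (rule swapped)
      by (simp_all add: S' p q 4 entry_simps)
  qed
qed

section \<open>Exactly one nonzero eigenvalue\<close>

text \<open>
  The kernel of \<open>D\<close> is \<open>\<real>[v]\<close> with \<open>v \<cdot> v = k v\<close>, so it is \<open>\<real> \<times> \<real>\<close> or the dual numbers. If \<open>v \<cdot> w = 0\<close>,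
  these are the two models with \<open>e\<^sub>1 \<cdot> e\<^sub>2 = 0\<close>. Otherwise the element \<open>f = e + c v\<close> with
  \<open>c = - l / p\<close> acts on \<open>w\<close> as the identity from both sides, as \<open>e\<^sub>1\<close> does in the remaining models, and it satisfies
  \<open>f \<cdot> f = t f - (t - 1) e\<close> with \<open>t = 2 + c k\<close>. The three families are the cases \<open>t = 0\<close>, \<open>t = 1\<close> and
  the generic one, where \<open>t = a / b\<close> is represented with \<open>b = 1\<close>.
\<close>
lemma one_nonzero_normalised_case:
  assumes ind: "indep3 e v w" and l: "l \<noteq> 0"
    and T: "e \<cdot> v = v" "e \<cdot> w = (1 + l) *\<^sub>R w" "v \<cdot> v = k *\<^sub>R v"
      "v \<cdot> w = p *\<^sub>R w" "w \<cdot> v = 0" "w \<cdot> w = 0"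
  shows classified
proof -
  have S: "e \<cdot> e = comb e v w 1 0 0" "v \<cdot> e = comb e v w 0 1 0" "w \<cdot> e = comb e v w 0 0 1"
    "e \<cdot> v = comb e v w 0 1 0" "e \<cdot> w = comb e v w 0 0 (1 + l)" "v \<cdot> v = comb e v w 0 k 0"
    "v \<cdot> w = comb e v w 0 0 p" "w \<cdot> v = comb e v w 0 0 0" "w \<cdot> w = comb e v w 0 0 0"
    by (simp_all add: right_id T comb_def)
  note S = S coords comb_eq_iff[OF ind] comb_eq_0_iff[OF ind]
  show ?thesis
  proof (cases "p = 0")
    case p: True
    show ?thesis
    proof (cases "k = 0")
      case True
      show ?thesis
        apply (rule classifiedI[OF h14[OF l]])
        apply (rule table_iso[where pa = 0 and pb = 1 and pc = 0 and qa = 0 and qb = 0 and qc = 1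
          and ra = "1/l" and rb = 0 and rc = 0, OF ind])
        by (simp_all add: S True p l entry_simps)
    next
      case False
      show ?thesis
        apply (rule classifiedI[OF h13[OF l]])
        apply (rule table_iso[where pa = 0 and pb = "1/k" and pc = 0 and qa = 0 and qb = 0 and qc = 1
          and ra = "1/l" and rb = 0 and rc = 0, OF ind])
        by (simp_all add: S False p l entry_simps)
    qed
  next
    case p: False
    define c where "c = - l / p"
    have c0: "c \<noteq> 0" using p l by (simp add: c_def)
    have c: "p = - l / c" using p l by (simp add: c_def)
    define t where "t = 2 + c * k"
    have ck: "k = (t - 2) / c" using c0 by (simp add: t_def)
    note iso' = table_iso[where pa = 1 and pb = c and pc = 0 and qa = 0 and qb = 0 and qc = 1
          and ra = "1/l" and rb = 0 and rc = 0, OF ind]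
    consider "t = 0" | "t = 1" | "t \<noteq> 0" "t \<noteq> 1" by blast
    then show ?thesis
    proof cases
      case 1
      show ?thesis
        apply (rule classifiedI[OF h12[OF l]])
        apply (rule iso')
        by (simp_all add: S 1 ck c c0 l entry_simps)
    next
      case 2
      show ?thesis
        apply (rule classifiedI[OF h11[OF l]])
        apply (rule iso')
        by (simp_all add: S 2 ck c c0 l entry_simps)
    next
      case 3
      show ?thesis
        apply (rule classifiedI[OF h10[of l t 1]])
        using l 3 apply simp_all
        apply (rule iso')
        by (simp_all add: S ck c c0 l entry_simps)
    qed
  qed
qed

text \<open>
  Eigenvalue considerations leave \<open>u \<cdot> u\<close> in the kernel of \<open>D\<close>, \<open>u \<cdot> w\<close> and \<open>w \<cdot> u\<close> multiples of \<open>w\<close>, and \<open>w \<cdot> w = 0\<close>.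
  By left symmetry on \<open>u, w, u\<close>, the kernel of \<open>D\<close> acts on \<open>w\<close> from the right by a character, with value
  \<open>q\<close> at \<open>u\<close>. Passing from \<open>u\<close> to \<open>v = u - q e\<close>, where the character vanishes, makes \<open>v \<cdot> v\<close> a multiple of \<open>v\<close>.
\<close>
lemma one_nonzero_case:
  assumes ind: "indep3 e u w" and l: "l \<noteq> 0"
    and eu: "e \<cdot> u = u" and ew: "e \<cdot> w = (1 + l) *\<^sub>R w"
  shows classified
proof -
  obtain a1 a2 a3 where uu: "u \<cdot> u = comb e u w a1 a2 a3" by (rule indep3_obtain[OF ind])
  obtain p1 p2 p where uw: "u \<cdot> w = comb e u w p1 p2 p" by (rule indep3_obtain[OF ind])
  obtain q1 q2 q where wu: "w \<cdot> u = comb e u w q1 q2 q" by (rule indep3_obtain[OF ind])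
  obtain s1 s2 s3 where ww: "w \<cdot> w = comb e u w s1 s2 s3" by (rule indep3_obtain[OF ind])
  have T: "e \<cdot> e = comb e u w 1 0 0" "u \<cdot> e = comb e u w 0 1 0" "w \<cdot> e = comb e u w 0 0 1"
    "e \<cdot> u = comb e u w 0 1 0" "e \<cdot> w = comb e u w 0 0 (1 + l)"
    by (simp_all add: right_id eu ew comb_def)
  note S = T uu uw wu ww coords comb_eq_iff[OF ind] comb_eq_0_iff[OF ind]
  have 1: "a3 = 0"
    using left_symmetric'[of e u u] l by (simp add: S algebra_simps)
  have 2: "p1 = 0" "p2 = 0"
    using left_symmetric'[of e u w] l by (simp_all add: S algebra_simps)
  have 3: "q1 = 0" "q2 = 0"
    using left_symmetric'[of e w u] l by (simp_all add: S algebra_simps)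
  have 4: "s1 = 0" "s2 = 0" "s3 = 0"
    using left_symmetric'[of e w w] l by (simp_all add: S algebra_simps)
  have 5: "a1 = q * q - a2 * q"
    using left_symmetric'[of u w u] 1 2 3 4 by (simp add: S algebra_simps)
  note S' = S 1 2 3 4 5
  define v where "v = comb e u w (- q) 1 0"
  have v: "comb e v w a b c = comb e u w (a - b * q) b c" for a b c
    by (simp add: v_def comb_def algebra_simps)
  show ?thesis
  proof (rule one_nonzero_normalised_case[OF _ l _ ew])
    show "indep3 e v w"
      unfolding v_def using indep3_replace[OF ind, where qa = "- q" and qb = 1 and qc = 0
          and ra = 0 and rb = 0 and rc = 1] by (simp add: comb_1 comb_3)
    show "e \<cdot> v = v" unfolding v_def by (simp add: S')
    show "v \<cdot> v = (a2 - 2 * q) *\<^sub>R v" unfolding v_def by (simp add: S' algebra_simps)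
    show "v \<cdot> w = (p - q * (1 + l)) *\<^sub>R w" unfolding v_def by (simp add: S') (simp add: comb_def)
    show "w \<cdot> v = 0" "w \<cdot> w = 0" unfolding v_def by (simp_all add: S')
  qed
qed

section \<open>Nonzero nilpotent derivation\<close>

text \<open>
  Left symmetry leaves \<open>z \<cdot> z = 0\<close>, \<open>z \<cdot> y = r\<^sub>3 z\<close> and \<open>y \<cdot> z = q\<^sub>3 z\<close>. Replacing \<open>y\<close> by \<open>y' = y - r\<^sub>3 e\<close> gives
  \<open>z \<cdot> y' = 0\<close>, \<open>y' \<cdot> z = \<alpha> z\<close> and \<open>y' \<cdot> y' = \<alpha> y' + B z\<close> with \<open>\<alpha> = q\<^sub>3 - r\<^sub>3\<close> and \<open>B = p\<^sub>3 - r\<^sub>3\<close>.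
  If \<open>\<alpha> \<noteq> 0\<close>, rescaling \<open>y'\<close> makes it \<open>1\<close>. If \<open>\<alpha> = 0\<close>, the algebra is a Heisenberg algebra, and \<open>B\<close> can be normalised
  to \<open>0\<close> or a fixed nonzero value.
\<close>
lemma nilpotent_case:
  assumes ind: "indep3 e y z" and ey: "e \<cdot> y = y + z" and ez: "e \<cdot> z = z"
  shows classified
proof -
  obtain p1 p2 p3 where yy: "y \<cdot> y = comb e y z p1 p2 p3" by (rule indep3_obtain[OF ind])
  obtain q1 q2 q3 where yz: "y \<cdot> z = comb e y z q1 q2 q3" by (rule indep3_obtain[OF ind])
  obtain r1 r2 r3 where zy: "z \<cdot> y = comb e y z r1 r2 r3" by (rule indep3_obtain[OF ind])
  obtain s1 s2 s3 where zz: "z \<cdot> z = comb e y z s1 s2 s3" by (rule indep3_obtain[OF ind])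
  have T: "e \<cdot> e = comb e y z 1 0 0" "y \<cdot> e = comb e y z 0 1 0" "z \<cdot> e = comb e y z 0 0 1"
    "e \<cdot> y = comb e y z 0 1 1" "e \<cdot> z = comb e y z 0 0 1"
    by (simp_all add: right_id ey ez comb_def)
  note S = T yy yz zy zz coords comb_eq_iff[OF ind] comb_eq_0_iff[OF ind]
  have 1: "p2 = q3 + r3" "q1 + r1 = 0" "q2 + r2 = 0"
    using left_symmetric'[of e y y] by (simp_all add: S)
  have 2: "s1 = 0" "s2 = 0" "s3 = q2"
    using left_symmetric'[of e y z] by (simp_all add: S)
  have 3: "q2 = 0" "r2 = 0"
    using left_symmetric'[of e z y] 1 2 by (simp_all add: S)
  have q1: "q1 = 0"
    using left_symmetric'[of y z z] 1 2 3 by (simp add: S)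
  have p1: "p1 = - q3 * r3"
    using left_symmetric'[of y z y] 1 2 3 q1 by (simp add: S algebra_simps)
  have zeros: "r1 = 0" "s3 = 0" using 1 2 3 q1 by auto
  note S' = S 1(1) 2 3 q1 p1 zeros
  show ?thesis
  proof (cases "q3 = r3")
    case False
    \<comment> \<open>In the model \<open>e = e\<^sub>1 + e\<^sub>2\<close>; here \<open>e\<^sub>2 = - t z\<close> and \<open>e\<^sub>3 = t y'\<close> with \<open>t = 1 / \<alpha>\<close>.\<close>
    define t where "t = 1 / (q3 - r3)"
    have t: "q3 = r3 + 1 / t" "t \<noteq> 0" using False by (auto simp: t_def)
    show ?thesis
      apply (rule classifiedI[OF h9[of "t * (r3 - p3)"]])
      apply (rule table_iso[where pa = 1 and pb = 0 and pc = t and qa = 0 and qb = 0 and qc = "-t"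
          and ra = "- r3 * t" and rb = t and rc = 0, OF ind])
      by (simp_all add: S' t entry_simps)
  next
    case True
    show ?thesis
    proof (cases "p3 = r3")
      case True': True
      show ?thesis
        apply (rule classifiedI[OF h16])
        apply (rule table_iso[where pa = "- r3" and pb = 1 and pc = 0 and qa = 1 and qb = 0 and qc = 0
          and ra = 0 and rb = 0 and rc = "-1", OF ind])
        by (simp_all add: S' True True' entry_simps)
    next
      case False
      define t where "t = 1 / (r3 - p3)"
      have t: "p3 = r3 - 1 / t" "t \<noteq> 0" using False by (auto simp: t_def)
      show ?thesis
        apply (rule classifiedI[OF h15])
        apply (rule table_iso[where pa = "- t * r3" and pb = t and pc = 0 and qa = 1 and qb = 0 and qc = 0
          and ra = 0 and rb = 0 and rc = "-t", OF ind])
        by (simp_all add: S' True t entry_simps)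
    qed
  qed
qed

section \<open>Two-sided identity, noncommutative product\<close>

text \<open>
  The bracket relation forces left multiplication by \<open>n\<close> to be nilpotent, and as it preserves the span of \<open>e\<close> and \<open>n\<close>
  here, \<open>n \<cdot> n = 0\<close> and \<open>n \<cdot> m = q n\<close>. With \<open>m' = m - q e\<close> one gets \<open>n \<cdot> m' = 0\<close>, \<open>m' \<cdot> n = n\<close> and
  \<open>m' \<cdot> m' = k m' + B n\<close>. Adding \<open>d n\<close> to \<open>m'\<close> changes \<open>B\<close> to \<open>B + d (1 - k)\<close>, so \<open>B\<close> can be
  prescribed unless \<open>k = 1\<close>.
\<close>
lemma unit_nilpotent_square_case:
  assumes ind: "indep3 e m n" and em: "e \<cdot> m = m" and en: "e \<cdot> n = n"
    and mn: "m \<cdot> n = n \<cdot> m + n" and nn: "n \<cdot> n = comb e m n c 0 a"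
  shows classified
proof -
  obtain C A B where mm: "m \<cdot> m = comb e m n C A B" by (rule indep3_obtain[OF ind])
  obtain p3 p1 q where nm: "n \<cdot> m = comb e m n p3 p1 q" by (rule indep3_obtain[OF ind])
  have T: "e \<cdot> e = comb e m n 1 0 0" "m \<cdot> e = comb e m n 0 1 0" "n \<cdot> e = comb e m n 0 0 1"
    "e \<cdot> m = comb e m n 0 1 0" "e \<cdot> n = comb e m n 0 0 1" "m \<cdot> n = comb e m n p3 p1 (q + 1)"
    using mn unfolding nm by (simp_all add: right_id em en comb_def algebra_simps)
  note S = T mm nm nn coords comb_eq_iff[OF ind] comb_eq_0_iff[OF ind]
  have E: "a * p1 + c = p1 * p1" "a = a * (q + 1) - p1 * q - (q + 1) * a - p3"
    "c = a * p3 - p1 * p3 - (q + 1) * c"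
    using left_symmetric'[of m n n] by (simp_all add: S algebra_simps)
  have F: "p1 = q * p1 + p3" "q = p1 * B + q * (q + 1) - A * q - B * a - C"
    using left_symmetric'[of m n m] by (simp_all add: S algebra_simps)
  have p3: "p3 = p1 - q * p1" using F by simp
  have a: "a = - p1" using E(2) p3 by (simp add: algebra_simps)
  have c: "c = 2 * (p1 * p1)" using E(1) a by simp
  have "6 * (p1 * p1) = 0" using E(3) unfolding c a p3 by (simp add: algebra_simps)
  then have p1: "p1 = 0" by simp
  have z: "p1 = 0" "p3 = 0" "a = 0" "c = 0" using p1 p3 a c by auto
  have C: "C = q * q - A * q" using F(2) z by (simp add: algebra_simps)
  note S' = S z C
  define k where "k = A - 2 * q"
  have A: "A = k + 2 * q" by (simp add: k_def)
  consider "k = 0" | "k = 1" "B = 0" | "k = 1" "B \<noteq> 0" | "k \<noteq> 0" "k \<noteq> 1" by blast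
  then show ?thesis
  proof cases
    case 1
    show ?thesis
      apply (rule classifiedI[OF h6])
      apply (rule table_iso[where pa = 1 and pb = 0 and pc = 0 and qa = 0 and qb = 0 and qc = 1
        and ra = "- q" and rb = 1 and rc = "- B", OF ind])
      by (simp_all add: S' A 1 entry_simps)
  next
    case 2
    show ?thesis
      apply (rule classifiedI[OF h5])
      apply (rule table_iso[where pa = 1 and pb = 0 and pc = 0 and qa = 0 and qb = 0 and qc = 1
        and ra = "- q" and rb = 1 and rc = 0, OF ind])
      by (simp_all add: S' A 2 entry_simps)
  next
    case 3
    show ?thesis
      apply (rule classifiedI[OF h4[of 1]], simp)
      apply (rule table_iso[where pa = 1 and pb = 0 and pc = 0 and qa = 0 and qb = 0 and qc = B
        and ra = "- q" and rb = 1 and rc = 0, OF ind])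
      by (simp_all add: S' A 3 entry_simps)
  next
    case 4
    define d where "d = (1 - B) / (1 - k)"
    have B: "B = 1 - d * (1 - k)" using 4 by (simp add: d_def)
    show ?thesis
      apply (rule classifiedI[OF h4[OF 4(1)]])
      apply (rule table_iso[where pa = 1 and pb = 0 and pc = 0 and qa = 0 and qb = 0 and qc = 1
        and ra = "- q" and rb = 1 and rc = d, OF ind])
      by (simp_all add: S' A B 4 entry_simps)
  qed
qed

text \<open>
  Here \<open>[w, n] = b n\<close> with \<open>w = n \<cdot> n\<close>. Left multiplication by \<open>n\<close> is nilpotent, which appears as \<open>n \<cdot> w = 0\<close>, and
  \<open>w \<cdot> w = 2 b w\<close> follows. Rescaling \<open>n\<close> normalises \<open>b\<close> up to its sign, which gives two models.
\<close>
lemma unit_cyclic_noncommutative_case: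
  assumes ind: "indep3 e n w" and en: "e \<cdot> n = n" and ew: "e \<cdot> w = w"
    and nn: "n \<cdot> n = w" and wn: "w \<cdot> n = n \<cdot> w + b *\<^sub>R n" and b: "b \<noteq> 0"
  shows classified
proof -
  obtain r p q where nw: "n \<cdot> w = comb e n w r p q" by (rule indep3_obtain[OF ind])
  obtain s1 s2 s3 where ww: "w \<cdot> w = comb e n w s1 s2 s3" by (rule indep3_obtain[OF ind])
  have T: "e \<cdot> e = comb e n w 1 0 0" "n \<cdot> e = comb e n w 0 1 0" "w \<cdot> e = comb e n w 0 0 1"
    "e \<cdot> n = comb e n w 0 1 0" "e \<cdot> w = comb e n w 0 0 1" "n \<cdot> n = comb e n w 0 0 1"
    "w \<cdot> n = comb e n w r (p + b) q"
    using wn unfolding nw by (simp_all add: right_id en ew nn comb_def algebra_simps)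
  note S = T nw ww coords comb_eq_iff[OF ind] comb_eq_0_iff[OF ind]
  have s: "s1 = q * r" "s2 = r + p * q" "s3 = 2 * b + p + q * q"
    using left_symmetric'[of w n n] by (auto simp: S algebra_simps)
  \<comment> \<open>The coordinates of \<open>n \<cdot> w\<close> have to be eliminated in this order: each equation
    simplifies to a multiple of the next unknown only after the previous one has been substituted.\<close>
  have p: "b * p = 0"
    using left_symmetric'[of w n w] by (auto simp: S s algebra_simps)
  then have p: "p = 0" using b by simp
  have "b * q = 0"
    using left_symmetric'[of w n w] by (auto simp: S s p algebra_simps)
  then have q: "q = 0" using b by simp
  have "b * r = 0"
    using left_symmetric'[of w n w] by (auto simp: S s p q algebra_simps)
  then have r: "r = 0" using b by simp
  note S' = S s p q r
  show ?thesis
  proof (cases "b > 0")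
    case True
    define t where "t = sqrt b"
    have t: "b = t * t" "t \<noteq> 0" using True by (auto simp: t_def)
    show ?thesis
      apply (rule classifiedI[OF h7])
      apply (rule table_iso[where pa = 1 and pb = 0 and pc = 0 and qa = 0 and qb = "1/t" and qc = 0
        and ra = 0 and rb = 0 and rc = "1/b", OF ind])
      by (simp_all add: S' t entry_simps)
  next
    case False
    define t where "t = sqrt (- b)"
    have t: "b = - (t * t)" "t \<noteq> 0" using False b by (auto simp: t_def)
    show ?thesis
      apply (rule classifiedI[OF h8])
      apply (rule table_iso[where pa = 1 and pb = 0 and pc = 0 and qa = 0 and qb = "1/t" and qc = 0
        and ra = 0 and rb = 0 and rc = "1/b", OF ind])
      by (simp_all add: S' t entry_simps)
  qed
qed

text \<open>
  The bracket is that of the affine algebra of the line plus a centre spanned by \<open>e\<close>; the cases are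
  distinguished by whether \<open>e, n, n \<cdot> n\<close> is a basis.
\<close>
lemma unit_affine_case:
  assumes ind: "indep3 e m n" and em: "e \<cdot> m = m" and en: "e \<cdot> n = n"
    and mn: "m \<cdot> n = n \<cdot> m + n"
  shows classified
proof -
  obtain c b a where nn: "n \<cdot> n = comb e m n c b a" by (rule indep3_obtain[OF ind])
  show ?thesis
  proof (cases "b = 0")
    case True
    with unit_nilpotent_square_case[OF ind em en mn] nn show ?thesis by simp
  next
    case False
    show ?thesis
    proof (rule unit_cyclic_noncommutative_case[OF _ en _ refl _ False])
      show "indep3 e n (n \<cdot> n)"
        using indep3_replace[OF ind, where qa = 0 and qb = 0 and qc = 1
          and ra = c and rb = b and rc = a] False by (simp add: comb_1 comb_3 nn)
      show "e \<cdot> (n \<cdot> n) = n \<cdot> n"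
        unfolding nn by (simp add: comb_def bil_simps right_id em en)
      show "n \<cdot> n \<cdot> n = n \<cdot> (n \<cdot> n) + b *\<^sub>R n"
        unfolding nn by (simp add: comb_def bil_simps right_id mn en algebra_simps)
    qed
  qed
qed

text \<open>
  Let \<open>n = [x, y] = g e + a x + b y\<close>. Since \<open>e\<close> is central, \<open>[x, n] = b n\<close> and \<open>[y, n] = - a n\<close>, so a multiple of
  \<open>x\<close> or of \<open>y\<close> serves as \<open>m\<close> with \<open>[m, n] = n\<close>, unless \<open>n = g e\<close>. That is impossible: \<open>g\<close> times the
  identity would be a commutator of left multiplications, which has trace zero.
\<close>
lemma unit_noncommutative_case:
  assumes ind: "indep3 e x y" and unit: "\<And>z. e \<cdot> z = z" and nc: "x \<cdot> y \<noteq> y \<cdot> x"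
  shows classified
proof -
  obtain g a b where br: "x \<cdot> y - y \<cdot> x = comb e x y g a b" by (rule indep3_obtain[OF ind])
  define n where "n = comb e x y g a b"
  have xy: "x \<cdot> y = y \<cdot> x + n" using br by (simp add: n_def algebra_simps)
  have xn: "x \<cdot> n = n \<cdot> x + b *\<^sub>R n"
    unfolding n_def using br by (simp add: coords right_id unit comb_def[of e x y] bil_simps xy[unfolded n_def] algebra_simps)
  have yn: "y \<cdot> n = n \<cdot> y - a *\<^sub>R n"
    unfolding n_def using br by (simp add: coords right_id unit comb_def[of e x y] bil_simps xy[unfolded n_def] algebra_simps)
  show ?thesis
  proof (cases "a = 0 \<and> b = 0")
    case False
    show ?thesis
    proof (cases "b = 0")
      case b: False
      show ?thesis
      proof (rule unit_affine_case[OF _ unit unit])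
        show "indep3 e (comb e x y 0 (1/b) 0) n"
          using indep3_replace[OF ind, where qa = 0 and qb = "1/b" and qc = 0
          and ra = g and rb = a and rc = b] b by (simp add: comb_1 n_def)
        show "comb e x y 0 (1/b) 0 \<cdot> n = n \<cdot> comb e x y 0 (1/b) 0 + n"
          using b by (simp add: coords xn algebra_simps)
      qed
    next
      case b: True
      with False have a: "a \<noteq> 0" by simp
      show ?thesis
      proof (rule unit_affine_case[OF _ unit unit])
        show "indep3 e (comb e x y 0 0 (-1/a)) n"
          using indep3_replace[OF ind, where qa = 0 and qb = 0 and qc = "-1/a"
          and ra = g and rb = a and rc = b] a by (simp add: comb_1 n_def)
        show "comb e x y 0 0 (-1/a) \<cdot> n = n \<cdot> comb e x y 0 0 (-1/a) + n"
          using a by (simp add: coords yn algebra_simps)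
      qed
    qed
  next
    case True
    obtain a1 b1 c1 where xx: "x \<cdot> x = comb e x y a1 b1 c1" by (rule indep3_obtain[OF ind])
    obtain a2 b2 c2 where yx: "y \<cdot> x = comb e x y a2 b2 c2" by (rule indep3_obtain[OF ind])
    obtain a4 b4 c4 where yy: "y \<cdot> y = comb e x y a4 b4 c4" by (rule indep3_obtain[OF ind])
    have T: "x \<cdot> e = comb e x y 0 1 0" "y \<cdot> e = comb e x y 0 0 1"
      "x \<cdot> y = comb e x y (a2 + g) b2 c2"
      "e \<cdot> e = comb e x y 1 0 0" "e \<cdot> x = comb e x y 0 1 0" "e \<cdot> y = comb e x y 0 0 1"
      using xy unfolding n_def yx using True by (simp_all add: right_id unit comb_def algebra_simps)
    note S = T xx yx yy coords comb_eq_iff[OF ind] comb_eq_0_iff[OF ind]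
    \<comment> \<open>Both equations are diagonal entries of the relation \<open>[L\<^sub>x, L\<^sub>y] = g\<close>, the ones at \<open>x\<close> and at \<open>y\<close>; the products in
      them cancel as in the trace.\<close>
    have "a2 + b2 * c2 = g + b4 * c1"
      using left_symmetric'[of x y x] by (simp add: S algebra_simps)
    moreover have "b4 * c1 = a2 + b2 * c2 + 2 * g"
      using left_symmetric'[of x y y] by (simp add: S algebra_simps)
    ultimately have "g = 0" by (simp add: algebra_simps)
    with True nc xy show ?thesis by (simp add: n_def comb_def)
  qed
qed

section \<open>Two-sided identity, commutative product\<close>

text \<open>The table is that of \<open>\<real>[y] / (y\<^sup>3 - y\<^sup>2 - b)\<close> in the basis \<open>y, y\<^sup>2 - y, 1\<close>.\<close>
lemma cyclic_generator:
  assumes ind: "indep3 e y (y \<cdot> y)" and unit: "\<And>z. e \<cdot> z = z" and comm: "\<And>u v. u \<cdot> v = v \<cdot> u"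
    and cubic: "y \<cdot> (y \<cdot> y) = y \<cdot> y + b *\<^sub>R e" and b: "b \<noteq> 0"
  shows classified
proof -
  define w where "w = y \<cdot> y"
  have ind': "indep3 e y w" using ind by (simp add: w_def)
  have yw: "y \<cdot> w = w + b *\<^sub>R e" using cubic by (simp add: w_def)
  have "w \<cdot> w = y \<cdot> (y \<cdot> w)"
    using left_symmetric'[of y w y] comm[of y w] by (simp add: w_def[symmetric])
  also have "\<dots> = w + b *\<^sub>R e + b *\<^sub>R y"
    by (simp add: yw bil_simps right_id)
  finally have T: "e \<cdot> e = comb e y w 1 0 0" "e \<cdot> y = comb e y w 0 1 0" "e \<cdot> w = comb e y w 0 0 1"
    "y \<cdot> e = comb e y w 0 1 0" "y \<cdot> y = comb e y w 0 0 1" "y \<cdot> w = comb e y w b 0 1"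
    "w \<cdot> e = comb e y w 0 0 1" "w \<cdot> y = comb e y w b 0 1" "w \<cdot> w = comb e y w b b 1"
    using yw comm[of y w] by (simp_all add: right_id unit comb_def w_def[symmetric])
  note S = T coords comb_eq_iff[OF ind'] comb_eq_0_iff[OF ind']
  show ?thesis
    apply (rule classifiedI[OF h2[OF b]])
    apply (rule table_iso[where pa = 0 and pb = 1 and pc = 0 and qa = 0 and qb = "-1" and qc = 1
          and ra = 1 and rb = 0 and rc = 0, OF ind'])
    by (simp_all add: S entry_simps)
qed

text \<open>
  In \<open>\<real>[x] / (x\<^sup>3 - q x - r)\<close> one needs a generator with minimal polynomial \<open>y\<^sup>3 - y\<^sup>2 - b\<close>, \<open>b \<noteq> 0\<close>, that is, an element whose
  conjugates have sum \<open>1\<close>, second elementary symmetric function \<open>0\<close>, and nonzero product \<open>b\<close>.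
  If \<open>q \<noteq> 0\<close> and \<open>r \<noteq> 0\<close>, then \<open>1 - x\<^sup>2 / q\<close> has these properties. If \<open>r = 0\<close>, the
  roots are those of \<open>x (x\<^sup>2 - q)\<close>. If \<open>q > 0\<close>, the element \<open>1/3 + x / k\<close> with \<open>k\<^sup>2 = 3 q\<close> serves, and if \<open>q < 0\<close> the algebra is
  \<open>\<real> \<times> \<complex>\<close> and the generator \<open>(-1, 1 + i)\<close> serves. If \<open>q = 0\<close> and \<open>r \<noteq> 0\<close>, then for \<open>x = k x'\<close> with \<open>x'\<^sup>3 = 1\<close>,
  an element \<open>1/3 + \<beta> x' + \<alpha> x'\<^sup>2\<close> has the required first two symmetric functions as soon as \<open>\<alpha> \<beta> = 1/9\<close>,
  and \<open>\<alpha> = 1, \<beta> = 1/9\<close> makes it a generator. Only \<open>x\<^sup>3 = 0\<close> has no such element and gives a model of its own.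
\<close>
lemma depressed_cubic_case:
  assumes ind: "indep3 e x w" and unit: "\<And>z. e \<cdot> z = z" and comm: "\<And>u v. u \<cdot> v = v \<cdot> u"
    and xx: "x \<cdot> x = w" and xw: "x \<cdot> w = r *\<^sub>R e + q *\<^sub>R x"
  shows classified
proof -
  have wx: "w \<cdot> x = r *\<^sub>R e + q *\<^sub>R x" using xw comm by simp
  have "w \<cdot> w = r *\<^sub>R x + q *\<^sub>R w"
    using left_symmetric'[of x w x] comm[of x w] by (simp add: xx wx bil_simps right_id)
  then have T: "e \<cdot> e = comb e x w 1 0 0" "e \<cdot> x = comb e x w 0 1 0" "e \<cdot> w = comb e x w 0 0 1"
    "x \<cdot> e = comb e x w 0 1 0" "x \<cdot> x = comb e x w 0 0 1" "x \<cdot> w = comb e x w r q 0"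
    "w \<cdot> e = comb e x w 0 0 1" "w \<cdot> x = comb e x w r q 0" "w \<cdot> w = comb e x w 0 r q"
    using xx xw wx by (simp_all add: right_id unit comb_def)
  note S = T coords comb_eq_iff[OF ind] comb_eq_0_iff[OF ind]
  \<comment> \<open>The primed coordinates are those of the square \<open>y\<^sup>2\<close> of \<open>y = g + s x + t x\<^sup>2\<close>.\<close>
  have gen: classified
    if sq: "comb e x w g s t \<cdot> comb e x w g s t = comb e x w g' s' t'"
      and det: "s * t' - t * s' \<noteq> 0" and b: "b \<noteq> 0"
      and cubic: "comb e x w g s t \<cdot> comb e x w g' s' t' = comb e x w (g' + b) s' t'"
    for g s t g' s' t' b
  proof (rule cyclic_generator[OF _ unit comm _ b])
    show "indep3 e (comb e x w g s t) (comb e x w g s t \<cdot> comb e x w g s t)"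
      using indep3_replace[OF ind, where qa = g and qb = s and qc = t
          and ra = g' and rb = s' and rc = t'] det by (simp add: comb_1 sq algebra_simps)
    show "comb e x w g s t \<cdot> (comb e x w g s t \<cdot> comb e x w g s t) =
          comb e x w g s t \<cdot> comb e x w g s t + b *\<^sub>R e"
      unfolding sq cubic by (simp add: comb_def algebra_simps)
  qed
  consider "q \<noteq> 0" "r \<noteq> 0" | "q > 0" "r = 0" | "q < 0" "r = 0" | "q = 0" "r \<noteq> 0" | "q = 0" "r = 0"
    by linarith
  then show ?thesis
  proof cases
    case 1
    define c where "c = r / q"
    have r: "r = c * q" "c \<noteq> 0" using 1 by (auto simp: c_def)
    show ?thesis
      apply (rule gen[where g = 1 and s = 0 and t = "- 1 / q" and g' = 1 and s' = "c / q" and t' = "-1/q" and b = "- c * c / q"])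
      using 1(1) r(2) by (simp_all add: S r(1) entry_simps)
  next
    case 2
    define k where "k = sqrt (3 * q)"
    have k: "q = k * k / 3" "k \<noteq> 0" using 2 by (auto simp: k_def)
    show ?thesis
      apply (rule gen[where g = "1/3" and s = "1/k" and t = 0 and g' = "1/9" and s' = "2/(3*k)" and t' = "1/(k*k)" and b = "- 2 / 27"])
      using k(2) by (simp_all add: S k(1) 2(2) entry_simps)
  next
    case 3
    define k where "k = sqrt (- q)"
    have k: "q = - (k * k)" "k \<noteq> 0" using 3 by (auto simp: k_def)
    show ?thesis
      apply (rule gen[where g = "- 1" and s = "1/k" and t = "-2/(k*k)" and g' = 1 and s' = "2/k" and t' = "1/(k*k)" and b = "- 2"])
      using k(2) by (simp_all add: S k(1) 3(2) entry_simps)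
  next
    case 4
    define k where "k = root 3 r"
    have k: "r = k * k * k" "k \<noteq> 0" using 4 odd_real_root_pow[of 3 r] by (auto simp: k_def power3_eq_cube)
    show ?thesis
      apply (rule gen[where g = "1/3" and s = "1/(9 * k)" and t = "1/(k*k)" and g' = "1/3" and s' = "29/(27*k)" and t' = "55/(81*k*k)" and b = "676/729"])
      using k(2) by (simp_all add: S k(1) 4(1) entry_simps)
  next
    case 5
    show ?thesis
      apply (rule classifiedI[OF h3])
      apply (rule table_iso[where pa = 0 and pb = 0 and pc = 1 and qa = 0 and qb = 1 and qc = 0
            and ra = 1 and rb = 0 and rc = 0, OF ind])
      by (simp_all add: S 5 entry_simps)
  qed
qed

text \<open>Translating the generator by a third of the quadratic coefficient depresses its cubic.\<close>
lemma cyclic_case: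
  assumes ind: "indep3 e x (x \<cdot> x)" and unit: "\<And>z. e \<cdot> z = z" and comm: "\<And>u v. u \<cdot> v = v \<cdot> u"
  shows classified
proof -
  define w where "w = x \<cdot> x"
  have ind': "indep3 e x w" using ind by (simp add: w_def)
  obtain r q p where xw: "x \<cdot> w = comb e x w r q (3 * p)"
    by (metis indep3_obtain[OF ind'] mult.commute nonzero_mult_div_cancel_left times_divide_eq_left zero_neq_numeral)
  have T: "e \<cdot> e = comb e x w 1 0 0" "e \<cdot> x = comb e x w 0 1 0" "e \<cdot> w = comb e x w 0 0 1"
    "x \<cdot> e = comb e x w 0 1 0" "x \<cdot> x = comb e x w 0 0 1"
    using unit right_id by (simp_all add: comb_def w_def)
  let ?x = "comb e x w (- p) 1 0"
  have sq: "?x \<cdot> ?x = comb e x w (p * p) (- 2 * p) 1" by (simp add: T coords)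
  show ?thesis
  proof (rule depressed_cubic_case[OF _ unit comm refl])
    show "indep3 e ?x (?x \<cdot> ?x)"
      using indep3_replace[OF ind', where qa = "- p" and qb = 1 and qc = 0
          and ra = "p * p" and rb = "- 2 * p" and rc = 1] by (simp add: comb_1 sq)
    have *: "A *\<^sub>R e + B *\<^sub>R ?x = comb e x w (A - p * B) B 0" for A B
      by (simp add: comb_def algebra_simps)
    show "?x \<cdot> (?x \<cdot> ?x) = (r + q * p + 2 * p * p * p) *\<^sub>R e + (q + 3 * p * p) *\<^sub>R ?x"
      unfolding sq * by (simp add: T xw coords algebra_simps)
  qed
qed

text \<open>
  If no element generates, every square \<open>z \<cdot> z\<close> lies in the span of \<open>e\<close> and \<open>z\<close>. For \<open>z = x, y, x + y, x - y\<close>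
  this expresses \<open>x \<cdot> x\<close> and \<open>y \<cdot> y\<close> by \<open>x \<cdot> y\<close> up to multiples of \<open>e\<close>, and associativity fixes those:
  \<open>x - c\<^sub>2 e\<close> and \<open>y - b\<^sub>2 e\<close> span an ideal of square zero.
\<close>
lemma unit_commutative_case:
  assumes ind: "indep3 e x y" and unit: "\<And>z. e \<cdot> z = z" and comm: "\<And>u v. u \<cdot> v = v \<cdot> u"
  shows classified
proof (cases "\<exists>z. indep3 e z (z \<cdot> z)")
  case True
  with cyclic_case unit comm show ?thesis by blast
next
  case False
  obtain a1 b1 c1 where xx: "x \<cdot> x = comb e x y a1 b1 c1" by (rule indep3_obtain[OF ind])
  obtain a2 b2 c2 where xy: "x \<cdot> y = comb e x y a2 b2 c2" by (rule indep3_obtain[OF ind])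
  obtain a4 b4 c4 where yy: "y \<cdot> y = comb e x y a4 b4 c4" by (rule indep3_obtain[OF ind])
  have T: "x \<cdot> e = comb e x y 0 1 0" "y \<cdot> e = comb e x y 0 0 1" "e \<cdot> e = comb e x y 1 0 0"
     "e \<cdot> x = comb e x y 0 1 0" "e \<cdot> y = comb e x y 0 0 1" "y \<cdot> x = comb e x y a2 b2 c2"
    using comm[of y x] by (simp_all add: right_id unit xy comb_def)
  note S = T xx xy yy coords comb_eq_iff[OF ind] comb_eq_0_iff[OF ind]
  have dep: "s * t' = t * s'" if "comb e x y 0 s t \<cdot> comb e x y 0 s t = comb e x y g' s' t'" for s t g' s' t'
  proof -
    have "\<not> indep3 e (comb e x y 0 s t) (comb e x y g' s' t')" using False that by metis
    then show ?thesis
      using indep3_replace[OF ind, where qa = 0 and qb = s and qc = t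
          and ra = g' and rb = s' and rc = t'] by (auto simp: comb_1 algebra_simps)
  qed
  have 1: "c1 = 0" using dep[of 1 0 a1 b1 c1] by (simp add: S)
  have 2: "b4 = 0" using dep[of 0 1 a4 b4 c4] by (simp add: S)
  have "c4 + 2 * c2 = b1 + 2 * b2"
    using dep[of 1 1 "a1 + 2 * a2 + a4" "b1 + 2 * b2" "c4 + 2 * c2"] 1 2 by (simp add: S)
  moreover have "c4 - 2 * c2 = - (b1 - 2 * b2)"
    using dep[of 1 "-1" "a1 - 2 * a2 + a4" "b1 - 2 * b2" "c4 - 2 * c2"] 1 2 by (simp add: S)
  ultimately have 3: "b1 = 2 * c2" "c4 = 2 * b2" by simp_all
  have 4: "a1 = - (c2 * c2)" "a2 = - (b2 * c2)"
    using left_symmetric'[of x y x] 1 2 3 by (auto simp: S algebra_simps)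
  have 5: "a4 = - (b2 * b2)"
    using left_symmetric'[of x y y] 1 2 3 4 by (auto simp: S algebra_simps)
  show ?thesis
    apply (rule classifiedI[OF h1])
    apply (rule table_iso[where pa = "- c2" and pb = 1 and pc = 0 and qa = "- b2" and qb = 0 and qc = 1
        and ra = 1 and rb = 0 and rc = 0, OF ind])
    by (simp_all add: S 1 2 3 4 5 entry_simps)
qed

section \<open>Normal form of the derivation and the classification\<close>

lemma obtain_basis_with:
  assumes "e \<noteq> 0"
  obtains x y where "indep3 e x y"
proof -
  have "independent {e}" using assms by simp
  then obtain B where B: "{e} \<subseteq> B" "independent B" "UNIV \<subseteq> span B"
    using maximal_independent_subset_extend[of "{e}" UNIV] by auto
  have "card B = 3" using basis_card_eq_dim[of B UNIV] B dim3 by simp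
  moreover have "e \<in> B" using B by simp
  ultimately have "card (B - {e}) = 2" by simp
  then obtain x y where xy: "B - {e} = {x, y}" "x \<noteq> y" by (meson card_2_iff)
  then have Bxy: "B = {e, x, y}" "e \<noteq> x" "e \<noteq> y" using \<open>e \<in> B\<close> by auto
  have "indep3 e x y"
    unfolding indep3_def
  proof (intro allI impI)
    fix a b c assume 0: "comb e x y a b c = 0"
    define f where "f z = (if z = e then a else if z = x then b else c)" for z
    have "(\<Sum>z\<in>B. f z *\<^sub>R z) = 0"
      using 0 Bxy xy(2) by (simp add: f_def comb_def add.assoc)
    then have "f z = 0" if "z \<in> B" for z
      using independentD[OF B(2) _ subset_refl _ that] Bxy(1) by blast
    moreover have "f e = a" "f x = b" "f y = c" using Bxy xy(2) by (auto simp: f_def)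
    ultimately show "a = 0 \<and> b = 0 \<and> c = 0" using Bxy(1) by force
  qed
  then show thesis by (rule that)
qed

text \<open>
  Here \<open>D\<close> is triangular in the basis \<open>e, x, y\<close> with diagonal \<open>0, l, m\<close>, which is the situation of real
  eigenvalues. Adding multiples of the earlier basis vectors removes every off-diagonal entry between
  distinct eigenvalues. Those between equal eigenvalues are either Jordan entries or entries \<open>D z = t e\<close>,
  and the latter vanish by \<open>not_in_image\<close>.
\<close>
lemma triangular_case:
  assumes ind: "indep3 e x y"
    and ex: "e \<cdot> x = r *\<^sub>R e + (1 + l) *\<^sub>R x"
    and ey: "e \<cdot> y = s *\<^sub>R e + c *\<^sub>R x + (1 + m) *\<^sub>R y"
  shows classified
proof -
  have e0: "e \<noteq> 0"
    using comb_eq_0_iff[OF ind, of 1 0 0] by (auto simp: comb_1)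
  have no: "t = 0" if "e \<cdot> z = z + t *\<^sub>R e" for z t
    using not_in_image[OF e0, of "(1/t) *\<^sub>R z"] that by (cases "t = 0") (auto simp: bil_simps algebra_simps)
  have T: "e \<cdot> e = comb e x y 1 0 0" "e \<cdot> x = comb e x y r (1 + l) 0" "e \<cdot> y = comb e x y s c (1 + m)"
    by (simp_all add: right_id ex ey comb_def)
  note S = T coords
  note base = indep3_replace[OF ind]
  consider "l = 0" "m = 0" | "l = 0" "m \<noteq> 0" | "l \<noteq> 0" "m = 0" | "l \<noteq> 0" "m \<noteq> 0" by blast
  then show ?thesis
  proof cases
    case 1
    have r: "r = 0" using no[of x r] ex 1 by (simp add: algebra_simps)
    show ?thesis
    proof (cases "c = 0")
      case True
      then have s: "s = 0" using no[of y s] ey 1 by (simp add: algebra_simps)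
      have unit: "e \<cdot> z = z" for z
      proof -
        obtain p q t where z: "z = comb e x y p q t" by (rule indep3_obtain[OF ind])
        show ?thesis unfolding z using 1 r True s by (simp add: S)
      qed
      show ?thesis
      proof (cases "x \<cdot> y = y \<cdot> x")
        case True
        have "u \<cdot> v = v \<cdot> u" for u v
        proof -
          obtain p q t where u: "u = comb e x y p q t" by (rule indep3_obtain[OF ind])
          obtain p' q' t' where v: "v = comb e x y p' q' t'" by (rule indep3_obtain[OF ind])
          show ?thesis unfolding u v by (simp add: comb_def bil_simps right_id unit True algebra_simps)
        qed
        with unit_commutative_case[OF ind unit] show ?thesis by blast
      next
        case False
        with unit_noncommutative_case[OF ind unit] show ?thesis by blast
      qed
    next
      case False
      show ?thesis
      proof (rule nilpotent_case)
        show "indep3 e y (comb e x y s c 0)"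
          using base[where qa = 0 and qb = 0 and qc = 1 and ra = s and rb = c and rc = 0] False
          by (simp add: comb_3)
        show "e \<cdot> y = y + comb e x y s c 0" using ey 1 by (simp add: comb_def algebra_simps)
        show "e \<cdot> comb e x y s c 0 = comb e x y s c 0" using 1 r by (simp add: S)
      qed
    qed
  next
    case 2
    have r: "r = 0" using no[of x r] ex 2 by (simp add: algebra_simps)
    show ?thesis
    proof (rule one_nonzero_case[OF _ 2(2)])
      show "indep3 e x (comb e x y (s / m) (c / m) 1)"
        using base[where qa = 0 and qb = 1 and qc = 0 and ra = "s/m" and rb = "c/m" and rc = 1]
        by (simp add: comb_2)
      show "e \<cdot> x = x" using ex 2 r by simp
      show "e \<cdot> comb e x y (s / m) (c / m) 1 = (1 + m) *\<^sub>R comb e x y (s / m) (c / m) 1"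
        using 2 r by (simp add: S algebra_simps add_divide_distrib)
    qed
  next
    case 3
    have "e \<cdot> comb e x y 0 (- c / l) 1 = comb e x y 0 (- c / l) 1 + (s - c * r / l) *\<^sub>R e"
    proof -
      have "comb e x y 0 (- c / l) 1 + (s - c * r / l) *\<^sub>R e = comb e x y (s - c * r / l) (- c / l) 1"
        by (simp add: comb_def algebra_simps)
      then show ?thesis using 3 by (simp add: S algebra_simps add_divide_distrib)
    qed
    then have "s - c * r / l = 0" by (rule no)
    then have s: "s = c * r / l" by simp
    show ?thesis
    proof (rule one_nonzero_case[OF _ 3(1)])
      show "indep3 e (comb e x y 0 (- c / l) 1) (comb e x y (r / l) 1 0)"
        using base[where qa = 0 and qb = "- c / l" and qc = 1 and ra = "r/l" and rb = "1" and rc = 0]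
        by simp
      show "e \<cdot> comb e x y 0 (- c / l) 1 = comb e x y 0 (- c / l) 1"
        using 3 s by (simp add: S algebra_simps add_divide_distrib)
      show "e \<cdot> comb e x y (r / l) 1 0 = (1 + l) *\<^sub>R comb e x y (r / l) 1 0"
        using 3 by (simp add: S algebra_simps add_divide_distrib)
    qed
  next
    case 4
    let ?x = "comb e x y (r / l) 1 0"
    have x: "e \<cdot> ?x = (1 + l) *\<^sub>R ?x" using 4 by (simp add: S algebra_simps add_divide_distrib)
    show ?thesis
    proof (cases "l = m")
      case False
      define k where "k = c / (m - l)"
      have c: "c = k * (m - l)" using False by (simp add: k_def)
      define y' where "y' = comb e x y ((s + k * r) / m) k 1"
      have y': "e \<cdot> y' = (1 + m) *\<^sub>R y'"
        unfolding y'_def using 4 c by (simp add: S comb_eq_iff[OF ind] algebra_simps add_divide_distrib)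
      have i: "indep3 e ?x y'" "indep3 e y' ?x"
        unfolding y'_def
        using base[where qa = "r/l" and qb = 1 and qc = 0 and ra = "(s + k * r) / m" and rb = k and rc = 1]
          base[where ra = "r/l" and rb = 1 and rc = 0 and qa = "(s + k * r) / m" and qb = k and qc = 1]
        by simp_all
      show ?thesis
        by (rule disjE[OF linear[of "\<bar>m\<bar>" "\<bar>l\<bar>"]])
          (rule diagonal_case[OF i(1) 4 _ x y'], assumption,
           rule diagonal_case[OF i(2) 4(2,1) _ y' x], assumption)
    next
      case True
      show ?thesis
      proof (cases "c = 0")
        case c: True
        show ?thesis
        proof (rule diagonal_case[OF _ 4 _ x])
          show "indep3 e ?x (comb e x y (s / m) 0 1)"
            using base[where qa = "r/l" and qb = 1 and qc = 0 and ra = "s / m" and rb = 0 and rc = 1]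
            by simp
          show "\<bar>m\<bar> \<le> \<bar>l\<bar>" using True by simp
          show "e \<cdot> comb e x y (s / m) 0 1 = (1 + m) *\<^sub>R comb e x y (s / m) 0 1"
            using 4 c by (simp add: S algebra_simps add_divide_distrib)
        qed
      next
        case c: False
        let ?y = "comb e x y ((s - c * r / l) / m) 0 1"
        show ?thesis
        proof (rule jordan_case[OF _ 4(1)])
          show "indep3 e (comb e x y (c * r / l) c 0) ?y"
            using base[where qa = "c * r/l" and qb = c and qc = 0
                and ra = "(s - c * r / l) / m" and rb = 0 and rc = 1] c by simp
          show "e \<cdot> comb e x y (c * r / l) c 0 = (1 + l) *\<^sub>R comb e x y (c * r / l) c 0"
            using 4 by (simp add: S algebra_simps add_divide_distrib)
          show "e \<cdot> ?y = (1 + l) *\<^sub>R ?y + comb e x y (c * r / l) c 0"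
            using 4 unfolding True by (simp add: S[unfolded True] algebra_simps diff_divide_distrib add_divide_distrib)
        qed
      qed
    qed
  qed
qed

text \<open>
  On the quotient by \<open>e\<close>, the derivation \<open>D\<close> is given by \<open>a, b, c, d\<close>. If its discriminant
  \<open>(a - d)\<^sup>2 + 4 b c\<close> is nonnegative, there is a real eigenvector and \<open>D\<close> is triangular. Otherwise \<open>D\<close> has eigenvalues
  \<open>p \<plusminus> i q\<close> with \<open>q > 0\<close>, and its image is an invariant complement of \<open>e\<close>, on which \<open>D\<close> satisfies
  \<open>D\<^sup>2 = 2 p D - (p\<^sup>2 + q\<^sup>2)\<close> by the Cayley-Hamilton theorem. So \<open>u = D x\<close> and \<open>v = (D u - p u) / q\<close> form a basis of the image
  on which \<open>D\<close> is \<open>p\<close> plus \<open>q\<close> times a rotation.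
\<close>
lemma classification:
  assumes ind: "indep3 e x y"
  shows classified
proof -
  obtain r a b where ex: "e \<cdot> x - x = comb e x y r a b" by (rule indep3_obtain[OF ind])
  obtain s c d where ey: "e \<cdot> y - y = comb e x y s c d" by (rule indep3_obtain[OF ind])
  have T: "e \<cdot> e = comb e x y 1 0 0" "e \<cdot> x = comb e x y r (1 + a) b" "e \<cdot> y = comb e x y s c (1 + d)"
    using ex ey by (simp_all add: right_id comb_def algebra_simps)
  note S = T coords
  note base = indep3_replace[OF ind]
  show ?thesis
  proof (cases "(a - d)\<^sup>2 + 4 * b * c \<ge> 0")
    case True
    show ?thesis
    proof (cases "b = 0")
      case True
      show ?thesis
        by (rule triangular_case[OF ind, of r a s c d]) (simp_all add: T True comb_def)
    next
      case False
      define h where "h = sqrt ((a - d)\<^sup>2 + 4 * b * c)"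
      define l where "l = (a + d + h) / 2"
      have "2 * l - a - d = h" by (simp add: l_def add_divide_distrib)
      moreover have "h\<^sup>2 = (a - d)\<^sup>2 + 4 * b * c" using True by (simp add: h_def)
      ultimately have "(2 * l - a - d)\<^sup>2 = (a - d)\<^sup>2 + 4 * b * c" by simp
      then have l: "l * l = (a + d) * l - a * d + b * c"
        by (simp add: power2_eq_square algebra_simps)
      define v where "v = comb e x y 0 (l - d) b"
      have v: "e \<cdot> v = comb e x y (r * (l - d) + s * b) ((1 + l) * (l - d)) ((1 + l) * b)"
        unfolding v_def by (simp add: S) (simp add: algebra_simps l)
      show ?thesis
      proof (rule triangular_case[of v x "r * (l - d) + s * b" l "r" 1 "a + d - l"])
        show "indep3 e v x"
          unfolding v_def using base[where qa = 0 and qb = "l - d" and qc = b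
                and ra = 0 and rb = 1 and rc = 0] False by (simp add: comb_2)
        show "e \<cdot> v = (r * (l - d) + s * b) *\<^sub>R e + (1 + l) *\<^sub>R v"
          unfolding v by (simp add: v_def comb_def algebra_simps)
        show "e \<cdot> x = r *\<^sub>R e + 1 *\<^sub>R v + (1 + (a + d - l)) *\<^sub>R x"
          unfolding T v_def by (simp add: comb_def algebra_simps)
      qed
    qed
  next
    case False
    define p where "p = (a + d) / 2"
    define q where "q = sqrt (- ((a - d)\<^sup>2 + 4 * b * c)) / 2"
    have q0: "q > 0" using False by (simp add: q_def)
    have qq: "4 * (q * q) = - ((a - d)\<^sup>2 + 4 * b * c)"
    proof -
      have "(2 * q)\<^sup>2 = - ((a - d)\<^sup>2 + 4 * b * c)" using False by (simp add: q_def)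
      then show ?thesis by (simp add: power2_eq_square)
    qed
    have bc: "b \<noteq> 0" using False by auto
    have d: "d = 2 * p - a" by (simp add: p_def add_divide_distrib)
    define \<Delta> where "\<Delta> = q * q + p * p"
    have D0: "\<Delta> \<noteq> 0" unfolding \<Delta>_def using q0 by (smt (verit) mult_pos_pos zero_le_square)
    have det: "b * c = a * d - \<Delta>"
      using qq unfolding d \<Delta>_def by (simp add: power2_eq_square algebra_simps)
    have bc': "b * c = a * (2 * p - a) - q * q - p * p"
      using det unfolding d \<Delta>_def by simp
    \<comment> \<open>The coordinates of \<open>(D u - p u) / q\<close>, simplified by means of the characteristic equation.\<close>
    define v1 v2 v3 where "v1 = (a * r + b * s - p * r) / q"
      and "v2 = (p * a - q * q - p * p) / q" and "v3 = p * b / q"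
    have qv: "q * v1 = a * r + b * s - p * r" "q * v2 = p * a - q * q - p * p" "q * v3 = p * b"
      using q0 by (simp_all add: v1_def v2_def v3_def)
    define u where "u = comb e x y r a b"
    define v where "v = comb e x y v1 v2 v3"
    show ?thesis
    proof (rule rotation_case[of u v q p])
      have "q * (a * v3 - v2 * b) = a * (q * v3) - (q * v2) * b" by (simp add: algebra_simps)
      also have "\<dots> = b * \<Delta>" unfolding qv \<Delta>_def by (simp add: algebra_simps)
      finally have "q * (a * v3 - v2 * b) \<noteq> 0" using bc D0 by simp
      then have "a * v3 \<noteq> v2 * b" by auto
      then show "indep3 e u v" unfolding u_def v_def by (rule indep3_replace[OF ind])
      show "q \<noteq> 0" using q0 by simp
      show "e \<cdot> u = (1 + p) *\<^sub>R u + q *\<^sub>R v"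
        unfolding u_def v_def by (simp add: S qv bc' d algebra_simps)
      have "q * (r * v2 + s * v3 - p * v1 + q * r) = r * (q * v2) + s * (q * v3) - p * (q * v1) + q * q * r"
        by (simp add: algebra_simps)
      also have "\<dots> = 0" unfolding qv by (simp add: algebra_simps)
      finally have 1: "r * v2 + s * v3 = p * v1 - q * r" using q0 by simp
      have "q * (a * v2 + c * v3 - p * v2 + q * a) = a * (q * v2) + c * (q * v3) - p * (q * v2) + q * q * a"
        by (simp add: algebra_simps)
      also have "\<dots> = p * (b * c) - p * (a * (2 * p - a) - q * q - p * p)" unfolding qv by (simp add: algebra_simps)
      also have "\<dots> = 0" unfolding bc' by simp
      finally have 2: "a * v2 + c * v3 = p * v2 - q * a" using q0 by simp
      have "q * (b * v2 + d * v3 - p * v3 + q * b) = b * (q * v2) + d * (q * v3) - p * (q * v3) + q * q * b"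
        by (simp add: algebra_simps)
      also have "\<dots> = 0" unfolding qv d by (simp add: algebra_simps)
      finally have 3: "b * v2 + d * v3 = p * v3 - q * b" using q0 by simp
      have "e \<cdot> v = comb e x y (v1 + (r * v2 + s * v3)) (v2 + (a * v2 + c * v3)) (v3 + (b * v2 + d * v3))"
        unfolding v_def by (simp add: S algebra_simps)
      also have "\<dots> = (1 + p) *\<^sub>R v - q *\<^sub>R u"
        unfolding u_def v_def 1 2 3 by (simp add: coords algebra_simps)
      finally show "e \<cdot> v = (1 + p) *\<^sub>R v - q *\<^sub>R u" .
    qed
  qed
qed

end

theorem proposition10:
  fixes br nab :: "'a::real_vector \<Rightarrow> 'a \<Rightarrow> 'a"
  assumes "dim (UNIV :: 'a set) = 3"
    and "flat_lie_algebra br nab"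
    and "\<exists>e. right_identity nab e"
  shows "(\<exists>br' nab' e'. model br' nab' e' \<and> flat_isomorphic nab nab') \<and>
         (\<forall>br' nab' e'. model br' nab' e' \<longrightarrow>
            flat_lie_algebra br' nab' \<and> right_identity nab' e')"
proof
  obtain e where e: "right_identity nab e" using assms(3) by blast
  interpret flat_algebra3 nab e
  proof
    show "nab x (nab y z) - nab y (nab x z) = nab (nab x y - nab y x) z" for x y z
      using assms(2) unfolding flat_lie_algebra_def by (metis eq_iff_diff_eq_0)
  qed (use assms e in \<open>auto simp: flat_lie_algebra_def right_identity_def\<close>)
  have "e \<noteq> 0"
  proof
    assume "e = 0"
    then have "x = 0" for x :: 'a using right_id[of x] by (simp add: bil_simps)
    then have "(UNIV :: 'a set) \<subseteq> span {}" by auto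
    then have "dim (UNIV :: 'a set) = 0"
      by (rule dim_unique[OF empty_subsetI _ independent_empty card.empty])
    then show False using dim3 by simp
  qed
  then obtain x y where "indep3 e x y" by (rule obtain_basis_with)
  then show classified by (rule classification)
next
  show "\<forall>br' nab' e'. model br' nab' e' \<longrightarrow> flat_lie_algebra br' nab' \<and> right_identity nab' e'"
    using model_right_identity model_flat_lie_algebra by blast
qed

end
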